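(* Suppose Assumptions 1 and 2 (stated in the context) hold. Let $\mathcal{T}_{\mathrm b}$ be the number of elementary operations used by the batch learning algorithm for debiased Mondrian random forests described in the context, run on $n$ samples with forest size $B$, debiasing order $J\ge0$ and lifetime $\lambda$. Then its average case time complexity satisfies $$\mathbb{E}[\mathcal{T}_{\mathrm b}]\lesssim d(J+1)\big(nd(J+1)+B\big)+\frac{nBd(J+1)\log(2B(J+1))^d}{\lambda^d}.$$
   Context: Notation. $\mathbb{N}=\{0,1,2,\dots\}$; $a\wedge b$, $a\vee b$ are minimum and maximum. For non-negative sequences, $a_n\lesssim b_n$ (equivalently $b_n\gtrsim a_n$) means $a_n/b_n$ is bounded over $n\ge1$ (with $d$, $J$, $x$, $a_r$, the law of the data fixed). $\mathbb{I}$ denotes an indicator. Elementary operations are arithmetic operations, comparisons, and draws of single exponential variables, each of unit cost, with standard matrix multiplication and inversion. Hölder classes. For $\beta>0$ let $\underline{\beta}=\lceil\beta-1\rceil$. Write $g\in\mathcal{H}^\beta$ if $g:[0,1]^d\to\mathbb{R}$ is $\underline\beta$ times differentiable and, for some $C>0$, $\max_{|\nu|=\underline\beta}|\partial^\nu g(x)-\partial^\nu g(x')|\le C\|x-x'\|_2^{\beta-\underline\beta}$ for all $x,x'\in[0,1]^d$ ($\nu\in\mathbb{N}^d$ a multi-index). Assumption 1 (data). Fix $d\ge1$. $(X_i,Y_i)$, $1\le i\le n$, are i.i.d. on $\mathbb{R}^d\times\mathbb{R}$. $X_i$ has a Lebesgue density $f$ on $[0,1]^d$, bounded away from zero, with $f\in\mathcal{H}^{\beta_f}$,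 $\beta_f>0$. $\mathbb{E}[Y_i^2\mid X_i]$ is bounded, $\mu(X_i)=\mathbb{E}[Y_i\mid X_i]$ with $\mu\in\mathcal{H}^{\beta_\mu}$, $\beta_\mu>0$. With $\varepsilon_i=Y_i-\mu(X_i)$, $\sigma^2(X_i)=\mathbb{E}[\varepsilon_i^2\mid X_i]$ is bounded away from zero with $\sigma^2\in\mathcal{H}^{\beta_\sigma}$, $\beta_\sigma>0$. Set $\beta=\beta_\mu\wedge(\beta_f+1)$. Assumption 2 (estimator). $x\in(0,1)^d$ is a fixed point; $\lambda=\lambda_n>0$ and $B=B_n\ge1$ satisfy $\lambda\gtrsim(\log n)^3$, $n/\lambda^d\to\infty$, and $B\gtrsim(\log n)^d$. The dimension $d$ does not depend on $n$. In the complexity bound $\lambda$ denotes this deterministic lifetime. Debiasing constants. $J\ge0$ is fixed, $a_0,\dots,a_J>0$ are distinct constants, and $\omega_0,\dots,\omega_J$ solve $\sum_r\omega_r=1$, $\sum_r\omega_ra_r^{-2s}=0$ for $1\le s\le J$. $\bar\omega=\sum_r\omega_ra_r^{-2J-2}$, $\ell_{rr'}=\frac{2a_r}{3}\big(1-\frac{a_r}{a_{r'}}\log(1+\frac{a_{r'}}{a_r})\big)$. Trees. Only the cells $T_{br}(x)$ ($1\le b\le B$, $0\le r\le J$) containing $x$ in independent Mondrian trees with lifetimes $a_r\lambda$ are needed. They are sampled independently of the data as $T_{br}(x)=\prod_{j=1}^d[T_{br}(x)_j^-,T_{br}(x)_j^+]$ with $T_{br}(x)_j^-=0\vee(x_j-E_{brj1}/(a_r\lambda))$,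 $T_{br}(x)_j^+=1\wedge(x_j+E_{brj2}/(a_r\lambda))$, where $E_{brj1},E_{brj2}$ are i.i.d. $\mathrm{Exp}(1)$. Batch algorithm. Input: data, $B$, $J$. 1. Select the lifetime by plug-in polynomial estimation: fit by least squares a polynomial in each coordinate of order $2J+4$ without interaction terms (design matrix $\mathbf{P}$ of size $n\times((2J+4)d+1)$ with rows $(1,X_{i1},\dots,X_{i1}^{2J+4},\dots,X_{id},\dots,X_{id}^{2J+4})$), let $\partial_j^{2J+2}\hat\mu(x)$ be the corresponding derivative of the fitted polynomial and $\hat\sigma^2=\frac{1}{n-(2J+4)d-1}(\mathbf{Y}^{\mathsf T}\mathbf{Y}-\mathbf{Y}^{\mathsf T}\mathbf{P}(\mathbf{P}^{\mathsf T}\mathbf{P})^{-1}\mathbf{P}^{\mathsf T}\mathbf{Y})$, and compute $\hat\lambda_J=\left(\frac{\frac{(4J+4)\bar\omega^2}{(J+2)^2}n\big(\sum_j\partial_j^{2J+2}\hat\mu(x)\big)^2}{d\hat\sigma^2\sum_{r,r'}\omega_r\omega_{r'}(\ell_{rr'}+\ell_{r'r})^d}\right)^{1/(4J+4+d)}$. Also compute the $\omega_r$. 2. Construct the union cell $U(x)=\prod_{j=1}^d\bigcup_{b=1}^B\bigcup_{r=0}^JT_{br}(x)_j$, where $T_{br}(x)_j$ is the $j$th side of $T_{br}(x)$, and the active indices $I(x)=\{1\le i\le n:X_i\in U(x)\}$. 3. For all $b,r$ compute $N_{br}(x)=\sum_{i\in I(x)}\mathbb{I}\{X_i\in T_{br}(x)\}$,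 $S_{br}(x)=\sum_{i\in I(x)}Y_i\mathbb{I}\{X_i\in T_{br}(x)\}$, $V_{br}(x)=\sum_{i\in I(x)}Y_i^2\mathbb{I}\{X_i\in T_{br}(x)\}$. 4. Compute $\hat\mu_{\mathrm d}(x)=\sum_r\omega_r\frac1B\sum_bS_{br}(x)/N_{br}(x)$ and $\hat\sigma^2(x)=\frac1B\sum_bV_{b0}(x)/N_{b0}(x)-\big(\frac1B\sum_bS_{b0}(x)/N_{b0}(x)\big)^2$ ($0/0=0$). 5. Compute $\hat\Sigma_{\mathrm d}(x)=\hat\sigma^2(x)\frac{n}{\lambda^d}\sum_{i\in I(x)}\big(\sum_r\omega_r\frac1B\sum_b\frac{\mathbb{I}\{X_i\in T_{br}(x)\}}{N_{br}(x)}\big)^2$ and the confidence interval with endpoints $\hat\mu_{\mathrm d}(x)-\sqrt{\lambda^d/n}\,\hat\Sigma_{\mathrm d}(x)^{1/2}q$ for $q\in\{q_{1-\alpha/2},q_{\alpha/2}\}$ (normal quantiles). *)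

theory Defs
  imports "HOL-Probability.Probability" "HOL-Library.State_Monad"
begin

section \<open>Asymptotic comparison\<close>

text \<open>Boundedness of the ratio over all \<open>n \<ge> 1\<close>, not only eventually.\<close>

definition lesssim :: "(nat \<Rightarrow> real) \<Rightarrow> (nat \<Rightarrow> real) \<Rightarrow> bool" where
  "lesssim u v \<longleftrightarrow> (\<exists>C. \<forall>n\<ge>1. u n \<le> C * v n)"


section \<open>Hoelder classes on the unit cube\<close>

text \<open>Derivatives are taken within the closed cube, hence one-sided at its boundary.
  A list \<open>js\<close> of coordinate directions stands for the multi-index counting its entries;
  the order of differentiation is immaterial whenever all these derivatives exist.\<close>

fun partials :: "'d::finite list \<Rightarrow> (real ^ 'd \<Rightarrow> real) \<Rightarrow> real ^ 'd \<Rightarrow> real" where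
  "partials [] g = g"
| "partials (j # js) g =
     (\<lambda>x. frechet_derivative (partials js g) (at x within cbox 0 1) (axis j 1))"

definition holder :: "real \<Rightarrow> (real ^ 'd::finite \<Rightarrow> real) \<Rightarrow> bool" where
  "holder \<beta> g \<longleftrightarrow>
    (let k = nat \<lceil>\<beta> - 1\<rceil> in
      (\<forall>js. length js < k \<longrightarrow> partials js g differentiable_on cbox 0 1) \<and>
      (\<exists>C>0. \<forall>js. length js = k \<longrightarrow>
         (\<forall>x\<in>cbox 0 1. \<forall>x'\<in>cbox 0 1.
            \<bar>partials js g x - partials js g x'\<bar> \<le> C * norm (x - x') powr (\<beta> - real k))))"


section \<open>Normal quantiles\<close>

definition normal_quantile :: "real \<Rightarrow> real" where
  "normal_quantile p = Inf {q. p \<le> cdf std_normal_distribution q}"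


section \<open>Programs that count elementary operations\<close>

text \<open>The state is the number of elementary operations performed so far.  Arithmetic is done
  only through \<open>calc\<close>, which charges one unit per operator occurring in the expression;
  \<open>return\<close>, access to stored values, and loop control on indices are free.
  Division is that of HOL, so that \<open>0/0 = 0\<close>.\<close>

type_synonym 'a prog = "(nat, 'a) state"

definition elem :: "'a \<Rightarrow> 'a prog" where
  "elem v = State (\<lambda>c. (v, Suc c))"

datatype expr =
    Val real
  | Add expr expr  (infixl \<open>\<oplus>\<close> 65)
  | Sub expr expr  (infixl \<open>\<ominus>\<close> 65)
  | Mul expr expr  (infixl \<open>\<otimes>\<close> 70)
  | Div expr expr  (infixl \<open>\<oslash>\<close> 70)
  | Powr expr expr
  | Ln expr
  | Sqrt expr
  | Lower expr expr
  | Upper expr expr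

primrec eval_expr :: "expr \<Rightarrow> real" where
  "eval_expr (Val v) = v"
| "eval_expr (s \<oplus> t) = eval_expr s + eval_expr t"
| "eval_expr (s \<ominus> t) = eval_expr s - eval_expr t"
| "eval_expr (s \<otimes> t) = eval_expr s * eval_expr t"
| "eval_expr (s \<oslash> t) = eval_expr s / eval_expr t"
| "eval_expr (Powr s t) = eval_expr s powr eval_expr t"
| "eval_expr (Ln s) = ln (eval_expr s)"
| "eval_expr (Sqrt s) = sqrt (eval_expr s)"
| "eval_expr (Lower s t) = min (eval_expr s) (eval_expr t)"
| "eval_expr (Upper s t) = max (eval_expr s) (eval_expr t)"

primrec expr_ops :: "expr \<Rightarrow> nat" where
  "expr_ops (Val v) = 0"
| "expr_ops (s \<oplus> t) = expr_ops s + expr_ops t + 1"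
| "expr_ops (s \<ominus> t) = expr_ops s + expr_ops t + 1"
| "expr_ops (s \<otimes> t) = expr_ops s + expr_ops t + 1"
| "expr_ops (s \<oslash> t) = expr_ops s + expr_ops t + 1"
| "expr_ops (Powr s t) = expr_ops s + expr_ops t + 1"
| "expr_ops (Ln s) = expr_ops s + 1"
| "expr_ops (Sqrt s) = expr_ops s + 1"
| "expr_ops (Lower s t) = expr_ops s + expr_ops t + 1"
| "expr_ops (Upper s t) = expr_ops s + expr_ops t + 1"

definition calc :: "expr \<Rightarrow> real prog" where
  "calc e = State (\<lambda>c. (eval_expr e, c + expr_ops e))"

definition le_test :: "real \<Rightarrow> real \<Rightarrow> bool prog" where
  "le_test u v = elem (u \<le> v)"

definition draw :: "real \<Rightarrow> real prog" where
  "draw e = elem e"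

abbreviation for_each :: "('i \<Rightarrow> 'a prog) \<Rightarrow> 'i list \<Rightarrow> 'a list prog" where
  "for_each \<equiv> State_Monad.traverse_list"

fun iterate :: "('i \<Rightarrow> 'a \<Rightarrow> 'a prog) \<Rightarrow> 'i list \<Rightarrow> 'a \<Rightarrow> 'a prog" where
  "iterate f [] s = State_Monad.return s"
| "iterate f (i # is) s = do { s' \<leftarrow> f i s; iterate f is s' }"

definition sum_of :: "('i \<Rightarrow> real prog) \<Rightarrow> 'i list \<Rightarrow> real prog" where
  "sum_of f is = iterate (\<lambda>i s. do { v \<leftarrow> f i; calc (Val s \<oplus> Val v) }) is 0"

definition prod_of :: "('i \<Rightarrow> real prog) \<Rightarrow> 'i list \<Rightarrow> real prog" where
  "prod_of f is = iterate (\<lambda>i s. do { v \<leftarrow> f i; calc (Val s \<otimes> Val v) }) is 1"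

definition all_of :: "('i \<Rightarrow> bool prog) \<Rightarrow> 'i list \<Rightarrow> bool prog" where
  "all_of f is = iterate (\<lambda>i s. do { v \<leftarrow> f i; elem (s \<and> v) }) is True"

definition pow :: "real \<Rightarrow> nat \<Rightarrow> real prog" where
  "pow u k = prod_of (\<lambda>_. State_Monad.return u) [0..<k]"

definition powers :: "real \<Rightarrow> nat \<Rightarrow> real list prog" where
  "powers u k = iterate (\<lambda>_ us. do { v \<leftarrow> calc (Val (last us) \<otimes> Val u);
                                     State_Monad.return (us @ [v]) }) [0..<k] [1]"


section \<open>Linear algebra\<close>

text \<open>A matrix is stored as the list of its rows.\<close>

definition dot :: "real list \<Rightarrow> real list \<Rightarrow> real prog" where
  "dot us vs = sum_of (\<lambda>(u, v). calc (Val u \<otimes> Val v)) (zip us vs)"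

definition col_of :: "real list list \<Rightarrow> nat \<Rightarrow> real list" where
  "col_of A k = map (\<lambda>row. row ! k) A"

definition gauss_jordan_step :: "nat \<Rightarrow> real list list \<Rightarrow> real list list prog" where
  "gauss_jordan_step k A = do {
     pivot \<leftarrow> for_each (\<lambda>v. calc (Val v \<oslash> Val (A ! k ! k))) (A ! k);
     for_each (\<lambda>i. if i = k then State_Monad.return pivot
                   else for_each (\<lambda>(u, v). calc (Val u \<ominus> Val (A ! i ! k) \<otimes> Val v))
                          (zip (A ! i) pivot)) [0..<length A]
   }"

text \<open>Gauss--Jordan elimination of \<open>(A | I)\<close>.  No row exchanges are needed for the two matrices
  that are inverted below: the leading principal minors are nonzero for an invertible
  Gram matrix and for a Vandermonde matrix with distinct nodes.\<close>

definition inverse_of :: "real list list \<Rightarrow> real list list prog" where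
  "inverse_of A = do {
     let m = length A;
     A' \<leftarrow> iterate gauss_jordan_step [0..<m]
             (map (\<lambda>i. A ! i @ map (\<lambda>j. if i = j then 1 else 0) [0..<m]) [0..<m]);
     State_Monad.return (map (drop m) A')
   }"


section \<open>The batch algorithm\<close>

definition coords :: "'d::finite list" where
  "coords = (SOME js. distinct js \<and> set js = UNIV)"

text \<open>The weights solve \<open>V \<omega> = e\<^sub>0\<close> with \<open>V\<^sub>s\<^sub>r = a\<^sub>r\<close> to the power \<open>- 2 s\<close>, so they form the first
  column of the inverse of \<open>V\<close>.  The second component is
  the weighted sum of the \<open>a\<^sub>r\<close> to the power \<open>- 2 J - 2\<close>.\<close>

definition debias_weights :: "nat \<Rightarrow> (nat \<Rightarrow> real) \<Rightarrow> (real list \<times> real) prog" where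
  "debias_weights J a = do {
     us \<leftarrow> for_each (\<lambda>r. do { u \<leftarrow> calc (Val 1 \<oslash> (Val (a r) \<otimes> Val (a r)));
                              powers u (Suc J) }) [0..<Suc J];
     Vinv \<leftarrow> inverse_of (map (col_of us) [0..<Suc J]);
     let \<omega> = col_of Vinv 0;
     \<omega>bar \<leftarrow> dot \<omega> (col_of us (Suc J));
     State_Monad.return (\<omega>, \<omega>bar)
   }"

definition ell :: "(nat \<Rightarrow> real) \<Rightarrow> nat \<Rightarrow> nat \<Rightarrow> real prog" where
  "ell a r r' =
     calc (Val 2 \<otimes> Val (a r) \<oslash> Val 3 \<otimes>
       (Val 1 \<ominus> Val (a r) \<oslash> Val (a r') \<otimes> Ln (Val 1 \<oplus> Val (a r') \<oslash> Val (a r))))"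

definition design_row :: "nat \<Rightarrow> real ^ 'd::finite \<Rightarrow> real list prog" where
  "design_row p z = do {
     ps \<leftarrow> for_each (\<lambda>j. powers (z $ j) p) coords;
     State_Monad.return (1 # concat (map tl ps))
   }"

text \<open>Least-squares coefficients and residual variance.\<close>

definition least_squares :: "nat \<Rightarrow> real list list \<Rightarrow> real list \<Rightarrow> (real list \<times> real) prog" where
  "least_squares m P ys = do {
     G \<leftarrow> for_each (\<lambda>k. for_each (\<lambda>l. dot (col_of P k) (col_of P l)) [0..<m]) [0..<m];
     h \<leftarrow> for_each (\<lambda>k. dot (col_of P k) ys) [0..<m];
     Ginv \<leftarrow> inverse_of G;
     \<gamma> \<leftarrow> for_each (\<lambda>row. dot row h) Ginv;
     yy \<leftarrow> dot ys ys;
     fit \<leftarrow> dot h \<gamma>;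
     s2 \<leftarrow> calc ((Val yy \<ominus> Val fit) \<oslash> (Val (real (length ys)) \<ominus> Val (real m)));
     State_Monad.return (\<gamma>, s2)
   }"

text \<open>The derivative of order \<open>q\<close> at \<open>u\<close> of the polynomial with coefficients \<open>c ! k\<close> of degree
  \<open>k + 1\<close> (the constant term, which plays no role for \<open>q > 0\<close>, is not stored).\<close>

definition poly_deriv :: "nat \<Rightarrow> real list \<Rightarrow> real \<Rightarrow> real prog" where
  "poly_deriv q c u =
     sum_of (\<lambda>k. do {
       ff \<leftarrow> prod_of (\<lambda>i. calc (Val (real k) \<ominus> Val (real i))) [0..<q];
       v \<leftarrow> pow u (k - q);
       calc (Val ff \<otimes> Val (c ! (k - 1)) \<otimes> Val v)
     }) [q..<Suc (length c)]"

definition select_lifetime ::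
  "nat \<Rightarrow> (nat \<Rightarrow> real ^ 'd::finite) \<Rightarrow> (nat \<Rightarrow> real) \<Rightarrow> nat \<Rightarrow> (nat \<Rightarrow> real) \<Rightarrow> real ^ 'd \<Rightarrow>
    (real \<times> real list) prog" where
  "select_lifetime n X Y J a x = do {
     let d = CARD('d);
     let p = 2 * J + 4;
     P \<leftarrow> for_each (\<lambda>i. design_row p (X i)) [0..<n];
     (\<gamma>, s2) \<leftarrow> least_squares (p * d + 1) P (map Y [0..<n]);
     D \<leftarrow> sum_of (\<lambda>(c, j). poly_deriv (2 * J + 2) (take p (drop (1 + c * p) \<gamma>)) (x $ j))
            (List.enumerate 0 coords);
     (\<omega>, \<omega>bar) \<leftarrow> debias_weights J a;
     L \<leftarrow> sum_of (\<lambda>r. sum_of (\<lambda>r'. do {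
            l \<leftarrow> ell a r r';
            l' \<leftarrow> ell a r' r;
            s \<leftarrow> calc (Val l \<oplus> Val l');
            v \<leftarrow> pow s d;
            calc (Val (\<omega> ! r) \<otimes> Val (\<omega> ! r') \<otimes> Val v) }) [0..<Suc J]) [0..<Suc J];
     lam \<leftarrow> calc (Powr
       ((Val 4 \<otimes> Val (real J) \<oplus> Val 4) \<otimes> (Val \<omega>bar \<otimes> Val \<omega>bar)
           \<oslash> ((Val (real J) \<oplus> Val 2) \<otimes> (Val (real J) \<oplus> Val 2))
           \<otimes> Val (real n) \<otimes> (Val D \<otimes> Val D)
         \<oslash> (Val (real d) \<otimes> Val s2 \<otimes> Val L))
       (Val 1 \<oslash> (Val 4 \<otimes> Val (real J) \<oplus> Val 4 \<oplus> Val (real d))));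
     State_Monad.return (lam, \<omega>)
   }"

text \<open>A box is stored as the list of its sides, in the order of \<open>coords\<close>.\<close>

type_synonym box = "(real \<times> real) list"

definition in_box :: "box \<Rightarrow> real ^ 'd::finite \<Rightarrow> bool prog" where
  "in_box T z = all_of (\<lambda>(j, l, u). do {
     p \<leftarrow> le_test l (z $ j);
     q \<leftarrow> le_test (z $ j) u;
     elem (p \<and> q) }) (zip coords T)"

text \<open>The exponential variables are supplied as the array \<open>E\<close>, whose entry \<open>(b, r, j, k)\<close> is read
  once, by \<open>draw\<close>; trees are numbered from \<open>0\<close>.\<close>

definition sample_cell ::
  "(nat \<times> nat \<times> 'd::finite \<times> nat \<Rightarrow> real) \<Rightarrow> (nat \<Rightarrow> real) \<Rightarrow> real \<Rightarrow> real ^ 'd \<Rightarrow> nat \<Rightarrow> nat \<Rightarrow>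
    box prog" where
  "sample_cell E a lam x b r = for_each (\<lambda>j. do {
     e1 \<leftarrow> draw (E (b, r, j, 1));
     e2 \<leftarrow> draw (E (b, r, j, 2));
     l \<leftarrow> calc (Upper (Val 0) (Val (x $ j) \<ominus> Val e1 \<oslash> (Val (a r) \<otimes> Val lam)));
     u \<leftarrow> calc (Lower (Val 1) (Val (x $ j) \<oplus> Val e2 \<oslash> (Val (a r) \<otimes> Val lam)));
     State_Monad.return (l, u) }) coords"

text \<open>All sides in a given direction contain the coordinate of \<open>x\<close>, so their union is the interval
  between the smallest lower and the largest upper end point.\<close>

definition union_cell :: "real ^ 'd::finite \<Rightarrow> box list \<Rightarrow> box prog" where
  "union_cell x Ts = iterate (\<lambda>T U. for_each (\<lambda>((l, u), (l', u')). do {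
       l'' \<leftarrow> calc (Lower (Val l) (Val l'));
       u'' \<leftarrow> calc (Upper (Val u) (Val u'));
       State_Monad.return (l'', u'') }) (zip T U)) Ts (map (\<lambda>j. (x $ j, x $ j)) coords)"

definition active_indices :: "nat \<Rightarrow> (nat \<Rightarrow> real ^ 'd::finite) \<Rightarrow> box \<Rightarrow> nat list prog" where
  "active_indices n X U = iterate (\<lambda>i I. do {
       c \<leftarrow> in_box U (X i);
       State_Monad.return (if c then I @ [i] else I) }) [0..<n] []"

definition cell_stats ::
  "(nat \<Rightarrow> real ^ 'd::finite) \<Rightarrow> (nat \<Rightarrow> real) \<Rightarrow> nat list \<Rightarrow> box \<Rightarrow> (real \<times> real \<times> real) prog" where
  "cell_stats X Y I T = iterate (\<lambda>i (N, S, V). do {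
       c \<leftarrow> in_box T (X i);
       let ind = of_bool c;
       N' \<leftarrow> calc (Val N \<oplus> Val ind);
       S' \<leftarrow> calc (Val S \<oplus> Val (Y i) \<otimes> Val ind);
       V' \<leftarrow> calc (Val V \<oplus> Val (Y i) \<otimes> Val (Y i) \<otimes> Val ind);
       State_Monad.return (N', S', V') }) I (0, 0, 0)"

text \<open>The mean over \<open>b < B\<close>.\<close>

definition forest_mean :: "nat \<Rightarrow> (nat \<Rightarrow> real prog) \<Rightarrow> real prog" where
  "forest_mean B f = do { s \<leftarrow> sum_of f [0..<B]; calc (Val s \<oslash> Val (real B)) }"

record batch_output =
  lambda_hat :: real
  mu_hat :: real
  sigma2_hat :: real
  Sigma_hat :: real
  ci_ends :: "real \<times> real"

text \<open>Cells and statistics are stored by \<open>r\<close> first and \<open>b\<close> second.  The lifetime estimate is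
  computed and returned, but the trees have lifetimes \<open>a r * lam\<close> for the given \<open>lam\<close>.\<close>

definition batch ::
  "real \<Rightarrow> (nat \<Rightarrow> real) \<Rightarrow> real ^ 'd::finite \<Rightarrow> nat \<Rightarrow> nat \<Rightarrow> nat \<Rightarrow> real \<Rightarrow>
    (nat \<Rightarrow> real ^ 'd) \<Rightarrow> (nat \<Rightarrow> real) \<Rightarrow> (nat \<times> nat \<times> 'd \<times> nat \<Rightarrow> real) \<Rightarrow>
    batch_output prog" where
  "batch \<alpha> a x n B J lam X Y E = do {
     (lamhat, \<omega>) \<leftarrow> select_lifetime n X Y J a x;

     Ts \<leftarrow> for_each (\<lambda>r. for_each (\<lambda>b. sample_cell E a lam x b r) [0..<B]) [0..<Suc J];
     U \<leftarrow> union_cell x (concat Ts);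
     I \<leftarrow> active_indices n X U;

     stats \<leftarrow> for_each (for_each (cell_stats X Y I)) Ts;
     let N = (\<lambda>b r. fst (stats ! r ! b));
     let S = (\<lambda>b r. fst (snd (stats ! r ! b)));
     let V = (\<lambda>b r. snd (snd (stats ! r ! b)));

     mu \<leftarrow> sum_of (\<lambda>r. do {
         m \<leftarrow> forest_mean B (\<lambda>b. calc (Val (S b r) \<oslash> Val (N b r)));
         calc (Val (\<omega> ! r) \<otimes> Val m) }) [0..<Suc J];
     m1 \<leftarrow> forest_mean B (\<lambda>b. calc (Val (S b 0) \<oslash> Val (N b 0)));
     m2 \<leftarrow> forest_mean B (\<lambda>b. calc (Val (V b 0) \<oslash> Val (N b 0)));
     s2 \<leftarrow> calc (Val m2 \<ominus> Val m1 \<otimes> Val m1);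

     Q \<leftarrow> sum_of (\<lambda>i. do {
         w \<leftarrow> sum_of (\<lambda>r. do {
             m \<leftarrow> forest_mean B (\<lambda>b. do {
                 c \<leftarrow> in_box (Ts ! r ! b) (X i);
                 calc (Val (of_bool c) \<oslash> Val (N b r)) });
             calc (Val (\<omega> ! r) \<otimes> Val m) }) [0..<Suc J];
         calc (Val w \<otimes> Val w) }) I;
     lamd \<leftarrow> pow lam CARD('d);
     Sig \<leftarrow> calc (Val s2 \<otimes> (Val (real n) \<oslash> Val lamd) \<otimes> Val Q);
     hi \<leftarrow> calc (Val 1 \<ominus> Val \<alpha> \<oslash> Val 2);
     lo \<leftarrow> calc (Val \<alpha> \<oslash> Val 2);
     qhi \<leftarrow> elem (normal_quantile hi);
     qlo \<leftarrow> elem (normal_quantile lo);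
     c1 \<leftarrow> calc (Val mu \<ominus> Sqrt (Val lamd \<oslash> Val (real n)) \<otimes> Sqrt (Val Sig) \<otimes> Val qhi);
     c2 \<leftarrow> calc (Val mu \<ominus> Sqrt (Val lamd \<oslash> Val (real n)) \<otimes> Sqrt (Val Sig) \<otimes> Val qlo);
     State_Monad.return \<lparr>lambda_hat = lamhat, mu_hat = mu, sigma2_hat = s2, Sigma_hat = Sig,
                        ci_ends = (c1, c2)\<rparr>
   }"

definition op_count :: "'a prog \<Rightarrow> nat" where
  "op_count p = snd (run_state p 0)"

end

theory Submission
  imports Defs
begin

text \<open>No branch of the algorithm influences its cost, except that steps 3 and 5 loop over the active
  indices.  Hence the cost is exactly \<open>c\<^sub>1 n + c\<^sub>2 B + c\<^sub>3 + |I(x)| (c\<^sub>4 B + c\<^sub>5)\<close> with constants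
  depending on \<open>d\<close> and \<open>J\<close> only, and only \<open>E |I(x)|\<close> has to be bounded.

  The union cell lies in the cube around \<open>x\<close> of half-width \<open>m / (c \<lambda>)\<close>, where \<open>m\<close> is the maximum of
  all \<open>2 d B (J + 1)\<close> exponential variables and \<open>c\<close> the least \<open>a\<^sub>r\<close>.  Since the data are independent of
  the trees and \<open>f\<close> is bounded, an index is active with probability at most a constant times
  \<open>E m\<^sup>d / \<lambda>\<^sup>d\<close>.  With \<open>N = 2 B (J + 1)\<close>, the pointwise bound
  \<open>m\<^sup>d \<le> (4 ln N)\<^sup>d + 4\<^sup>d d! exp (m / 2) / N\<close> and
  \<open>E exp (m / 2) \<le> \<Sum>\<^sub>k E exp (E\<^sub>k / 2) = 2 d N\<close> give \<open>E m\<^sup>d \<lesssim> (ln N)\<^sup>d\<close>; no independence of the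
  exponential variables among each other is needed.\<close>

section \<open>Programs of data-independent cost\<close>

text \<open>The cost \<open>k\<close> is exact (rather than an upper bound), which makes the number of operations a
  function of the number of active indices and thereby measurable.\<close>

definition runs :: "'a prog \<Rightarrow> nat \<Rightarrow> ('a \<Rightarrow> bool) \<Rightarrow> bool" where
  "runs p k P \<longleftrightarrow> (\<forall>c. \<exists>v. run_state p c = (v, c + k) \<and> P v)"

lemma runs_op_count: "runs p k P \<Longrightarrow> op_count p = k"
  by (metis add_0 op_count_def runs_def snd_conv)

lemma runs_weaken: "runs p k P \<Longrightarrow> k = l \<Longrightarrow> (\<And>v. P v \<Longrightarrow> Q v) \<Longrightarrow> runs p l Q"
  unfolding runs_def by metis

lemma runs_return: "P v \<Longrightarrow> runs (State_Monad.return v) 0 P"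
  by (simp add: runs_def)

lemma runs_elem: "P v \<Longrightarrow> runs (elem v) 1 P"
  by (simp add: runs_def elem_def)

lemma runs_calc: "expr_ops e = k \<Longrightarrow> P (eval_expr e) \<Longrightarrow> runs (calc e) k P"
  by (simp add: runs_def calc_def)

lemma runs_calc_any: "expr_ops e = k \<Longrightarrow> runs (calc e) k (\<lambda>_. True)"
  by (rule runs_calc) auto

lemma runs_bind:
  assumes "runs p k P" and "\<And>v. P v \<Longrightarrow> runs (f v) l Q"
  shows "runs (State_Monad.bind p f) (k + l) Q"
  unfolding runs_def
proof
  fix c
  obtain v where "run_state p c = (v, c + k)" "P v"
    using assms(1) unfolding runs_def by blast
  moreover obtain u where "run_state (f v) (c + k) = (u, c + k + l)" "Q u"
    using assms(2)[OF \<open>P v\<close>] unfolding runs_def by blast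
  ultimately show "\<exists>u. run_state (State_Monad.bind p f) c = (u, c + (k + l)) \<and> Q u"
    by (auto simp: add.assoc)
qed

lemma runs_bind_pair:
  assumes "runs p k P" and "\<And>u v. P (u, v) \<Longrightarrow> runs (f u v) l Q"
  shows "runs (State_Monad.bind p (\<lambda>(u, v). f u v)) (k + l) Q"
  using assms by (auto intro!: runs_bind)

text \<open>The cost \<open>k i\<close> may vary with the element: in Gauss-Jordan elimination the
  pivot row is free while the other rows are not. Elementwise postconditions allow lengths and
  values of the results to be recovered.\<close>

lemma runs_for_each:
  assumes "\<And>i. i \<in> set is \<Longrightarrow> runs (f i) (k i) (P i)"
  shows "runs (for_each f is) (sum_list (map k is)) (\<lambda>vs. list_all2 P is vs)"
  using assms
proof (induction "is")
  case (Cons i "is")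
  have "runs (f i) (k i) (P i)" and *: "runs (for_each f is) (sum_list (map k is)) (list_all2 P is)"
    using Cons by auto
  have "runs (for_each f (i # is)) (k i + (sum_list (map k is) + 0)) (list_all2 P (i # is))"
    unfolding State_Monad.traverse_list.simps
    by (rule runs_bind[OF \<open>runs (f i) (k i) (P i)\<close>], rule runs_bind[OF *], rule runs_return) simp
  then show ?case by simp
qed (auto intro: runs_return)

text \<open>The invariant also takes the processed prefix of the list, so that the final state can
  be described through all elements; this is how the union cell and the active indices are
  identified.\<close>

lemma runs_iterate:
  assumes "Inv [] s"
    and "\<And>i js s. i \<in> set is \<Longrightarrow> Inv js s \<Longrightarrow> runs (f i s) (k i) (Inv (js @ [i]))"
  shows "runs (iterate f is s) (sum_list (map k is)) (Inv is)"
proof -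
  \<comment> \<open>An arbitrary processed prefix \<open>js\<close> is allowed, because the prefix
    grows while the induction consumes the remaining list.\<close>
  have "runs (iterate f is' s) (sum_list (map k is')) (Inv (js @ is'))"
    if "Inv js s" "set is' \<subseteq> set is" for js is' s
    using that
  proof (induction is' arbitrary: js s)
    case (Cons i is')
    have "runs (f i s) (k i) (Inv (js @ [i]))"
      using Cons.prems by (intro assms(2)) auto
    moreover have "runs (iterate f is' s') (sum_list (map k is')) (Inv (js @ i # is'))"
      if "Inv (js @ [i]) s'" for s'
      using Cons.IH[OF that] Cons.prems(2) by simp
    ultimately show ?case
      by (auto intro: runs_bind)
  qed (auto intro: runs_return)
  from this[of "[]"] show ?thesis using assms(1) by simp
qed

lemma runs_iterate_any:
  assumes "\<And>i s. i \<in> set is \<Longrightarrow> runs (f i s) (k i) (\<lambda>_. True)"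
  shows "runs (iterate f is s) (sum_list (map k is)) (\<lambda>_. True)"
  using assms by (intro runs_iterate[where Inv = "\<lambda>_ _. True"]) auto

lemma runs_sum_of:
  assumes "\<And>i. i \<in> set is \<Longrightarrow> runs (f i) (k i) (\<lambda>_. True)"
  shows "runs (sum_of f is) (\<Sum>i\<leftarrow>is. k i + 1) (\<lambda>_. True)"
  unfolding sum_of_def
  by (rule runs_iterate_any, rule runs_bind[OF assms], assumption, rule runs_calc_any) simp

lemma runs_prod_of:
  assumes "\<And>i. i \<in> set is \<Longrightarrow> runs (f i) (k i) (\<lambda>_. True)"
  shows "runs (prod_of f is) (\<Sum>i\<leftarrow>is. k i + 1) (\<lambda>_. True)"
  unfolding prod_of_def
  by (rule runs_iterate_any, rule runs_bind[OF assms], assumption, rule runs_calc_any) simp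

text \<open>There is no short-circuiting: every test is run and conjoined at unit cost even after a
  failure, so the cost does not depend on the outcome.\<close>

lemma runs_all_of:
  assumes "\<And>i. i \<in> set is \<Longrightarrow> runs (f i) k (\<lambda>v. v = Q i)"
  shows "runs (all_of f is) (length is * (k + 1)) (\<lambda>v. v = (\<forall>i\<in>set is. Q i))"
proof -
  have "runs (all_of f is) (\<Sum>i\<leftarrow>is. k + 1) (\<lambda>v. v = (\<forall>i\<in>set is. Q i))"
    unfolding all_of_def
    by (rule runs_iterate[where Inv = "\<lambda>js v. v = (\<forall>i\<in>set js. Q i)"], simp)
       (rule runs_bind[OF assms], assumption, rule runs_elem, auto)
  then show ?thesis by (simp add: sum_list_triv)
qed

lemma runs_pow: "runs (pow u k) k (\<lambda>_. True)"
  unfolding pow_def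
  by (rule runs_weaken[OF runs_prod_of[OF runs_return]]) (auto simp: sum_list_triv)

lemma runs_powers: "runs (powers u k) k (\<lambda>us. length us = Suc k)"
proof -
  have "runs (powers u k) (\<Sum>i\<leftarrow>[0..<k]. 1) (\<lambda>us. length us = Suc (length [0..<k]))"
    unfolding powers_def
    by (rule runs_iterate[where Inv = "\<lambda>js us. length us = Suc (length js)"], simp,
        rule runs_weaken[OF runs_bind[OF runs_calc_any runs_return]]) auto
  then show ?thesis by (simp add: sum_list_triv)
qed

text \<open>Each pair costs one product and one addition, and \<open>zip\<close> cuts to the shorter
  list.\<close>

lemma runs_dot: "runs (dot us vs) (2 * min (length us) (length vs)) (\<lambda>_. True)"
proof -
  have "runs (dot us vs) (\<Sum>i\<leftarrow>zip us vs. 1 + 1) (\<lambda>_. True)"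
    unfolding dot_def
    by (rule runs_sum_of) (auto intro: runs_calc_any)
  then show ?thesis by (simp add: sum_list_triv mult_2)
qed

section \<open>The cost of the batch algorithm\<close>

abbreviation matrix_dims :: "nat \<Rightarrow> nat \<Rightarrow> real list list \<Rightarrow> bool" where
  "matrix_dims m l A \<equiv> length A = m \<and> (\<forall>row\<in>set A. length row = l)"

lemma runs_for_each_calc:
  assumes "\<And>i. i \<in> set is \<Longrightarrow> expr_ops (e i) = k"
  shows "runs (for_each (\<lambda>i. calc (e i)) is) (length is * k) (\<lambda>vs. length vs = length is)"
proof -
  have "runs (for_each (\<lambda>i. calc (e i)) is) (\<Sum>i\<leftarrow>is. expr_ops (e i))
      (\<lambda>vs. list_all2 (\<lambda>_ _. True) is vs)"
    by (intro runs_for_each runs_calc_any refl)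
  moreover have "(\<Sum>i\<leftarrow>is. expr_ops (e i)) = length is * k"
    using assms by (simp add: sum_list_triv cong: map_cong)
  ultimately show ?thesis
    by (auto dest: list_all2_lengthD elim!: runs_weaken)
qed

lemma list_all2_ball: "list_all2 (\<lambda>i v. Q v) is vs \<Longrightarrow> length vs = length is \<and> (\<forall>v\<in>set vs. Q v)"
  by (auto simp: list_all2_conv_all_nth in_set_conv_nth)

text \<open>Division is total, so a vanishing pivot changes nothing in the count and the dimensions
  are the only invariant to carry. Normalising the pivot row takes \<open>l\<close> divisions; every
  other row takes \<open>l\<close> products and \<open>l\<close> subtractions.\<close>

lemma runs_gauss_jordan_step:
  assumes "matrix_dims m l A" "k < m"
  shows "runs (gauss_jordan_step k A) (l + (\<Sum>i\<leftarrow>[0..<m]. if i = k then 0 else 2 * l)) (matrix_dims m l)"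
proof -
  have row: "length (A ! i) = l" if "i < m" for i
    using assms(1) that by auto
  have "runs (for_each (\<lambda>v. calc (Val v \<oslash> Val (A ! k ! k))) (A ! k)) l (\<lambda>vs. length vs = l)"
    using runs_for_each_calc[of "A ! k" "\<lambda>v. Val v \<oslash> Val (A ! k ! k)" 1] row[OF assms(2)] by simp
  moreover have "runs (for_each (\<lambda>i. if i = k then State_Monad.return pivot
                   else for_each (\<lambda>(u, v). calc (Val u \<ominus> Val (A ! i ! k) \<otimes> Val v))
                          (zip (A ! i) pivot)) [0..<length A])
      (\<Sum>i\<leftarrow>[0..<m]. if i = k then 0 else 2 * l) (matrix_dims m l)"
    if "length pivot = l" for pivot
  proof -
    have "runs (for_each (\<lambda>(u, v). calc (Val u \<ominus> Val (A ! i ! k) \<otimes> Val v))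
                          (zip (A ! i) pivot)) (2 * l) (\<lambda>vs. length vs = l)" if "i < m" for i
      using runs_for_each_calc[of "zip (A ! i) pivot"
          "\<lambda>(u, v). Val u \<ominus> Val (A ! i ! k) \<otimes> Val v" 2] row[OF that] \<open>length pivot = l\<close>
      by (auto simp: case_prod_beta' mult.commute)
    then show ?thesis
      using assms(1) that
      by (intro runs_weaken[OF runs_for_each[where P = "\<lambda>i v. length v = l" and k="\<lambda>i. if i = k then 0 else 2 * l"]])
         (auto intro: runs_return dest!: list_all2_ball)
  qed
  ultimately show ?thesis
    unfolding gauss_jordan_step_def by (rule runs_bind)
qed

text \<open>The order of quantifiers makes the cost a function of the size alone. Its value is
  irrelevant, since both inverted matrices have sizes fixed by \<open>d\<close> and
  \<open>J\<close>.\<close>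

lemma runs_inverse_of:
  "\<exists>k. \<forall>A. matrix_dims m m A \<longrightarrow> runs (inverse_of A) k (matrix_dims m m)"
proof (intro exI allI impI)
  fix A :: "real list list"
  assume A: "matrix_dims m m A"
  \<comment> \<open>The row length is \<open>m + m\<close> because elimination acts on
    \<open>A\<close> augmented by the identity.\<close>
  let ?k = "\<lambda>k. m + m + (\<Sum>i\<leftarrow>[0..<m]. if i = k then 0 else 2 * (m + m))"
  let ?A = "map (\<lambda>i. A ! i @ map (\<lambda>j. if i = j then 1 else 0) [0..<m]) [0..<m]"
  have "runs (iterate gauss_jordan_step [0..<m] ?A) (sum_list (map ?k [0..<m])) (matrix_dims m (m + m))"
    using A by (intro runs_iterate[where Inv = "\<lambda>_. matrix_dims m (m + m)"] runs_gauss_jordan_step) auto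
  then show "runs (inverse_of A) (sum_list (map ?k [0..<m]) + 0) (matrix_dims m m)"
    unfolding inverse_of_def Let_def A[THEN conjunct1] by (rule runs_bind[OF _ runs_return]) auto
qed

section \<open>Polynomial regression, debiasing weights and lifetime selection\<close>

lemma
  coords_distinct: "distinct (coords :: 'd::finite list)" and
  set_coords [simp]: "set (coords :: 'd::finite list) = UNIV"
proof -
  have "\<exists>js :: 'd list. distinct js \<and> set js = UNIV"
    using finite_distinct_list[of "UNIV :: 'd set"] by auto
  then have "distinct (coords :: 'd list) \<and> set (coords :: 'd list) = UNIV"
    unfolding coords_def by (rule someI_ex)
  then show "distinct (coords :: 'd::finite list)" "set (coords :: 'd::finite list) = UNIV"
    by auto
qed

lemma length_coords [simp]: "length (coords :: 'd::finite list) = CARD('d)"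
  using distinct_card[OF coords_distinct[where 'd = 'd]] by simp

lemma runs_design_row:
  "runs (design_row p (z :: real ^ 'd::finite)) (CARD('d) * p) (\<lambda>_. True)"
proof -
  have "runs (for_each (\<lambda>j. powers (z $ j) p) coords) (\<Sum>j\<leftarrow>(coords :: 'd list). p) (\<lambda>_. True)"
    by (rule runs_weaken[OF runs_for_each[where P = "\<lambda>_ _. True"]])
       (auto intro: runs_weaken[OF runs_powers])
  then have "runs (design_row p z) ((\<Sum>j\<leftarrow>(coords :: 'd list). p) + 0) (\<lambda>_. True)"
    unfolding design_row_def by (rule runs_bind[OF _ runs_return]) simp
  then show ?thesis by (simp add: sum_list_triv)
qed

text \<open>With the number \<open>m\<close> of columns fixed, \<open>n\<close> enters only through
  dot products of length \<open>n\<close>: \<open>m * m\<close> for the Gram matrix,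
  \<open>m\<close> for \<open>h\<close> and one for \<open>yy\<close>. The length of
  \<open>\<gamma>\<close> is exported because the derivative step cuts \<open>\<gamma>\<close> into
  blocks whose lengths determine its cost.\<close>

lemma runs_least_squares:
  "\<exists>k1 k2. \<forall>n P ys. length P = n \<and> length ys = n \<longrightarrow>
     runs (least_squares m P ys) (k1 * n + k2) (\<lambda>(\<gamma>, _). length \<gamma> = m)"
proof -
  obtain ki where ki: "\<And>A. matrix_dims m m A \<Longrightarrow> runs (inverse_of A) ki (matrix_dims m m)"
    using runs_inverse_of[of m] by blast
  have *: "runs (least_squares m P ys) ((2 * m * m + 2 * m + 2) * n + (ki + 2 * m * m + 2 * m + 3))
      (\<lambda>(\<gamma>, _). length \<gamma> = m)" if len: "length P = n" "length ys = n" for n P ys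
  proof -
    have G1: "runs (for_each (\<lambda>l. dot (col_of P k) (col_of P l)) [0..<m]) (2 * m * n) (\<lambda>v. length v = m)" for k
      using len
      by (intro runs_weaken[OF runs_for_each[where P = "\<lambda>_ _. True" and k = "\<lambda>_. 2 * n"]])
         (auto intro!: runs_weaken[OF runs_dot] simp: col_of_def sum_list_triv dest: list_all2_lengthD)
    have G: "runs (for_each (\<lambda>k. for_each (\<lambda>l. dot (col_of P k) (col_of P l)) [0..<m]) [0..<m])
         (2 * m * m * n) (matrix_dims m m)"
      by (intro runs_weaken[OF runs_for_each[OF G1]])
         (auto simp: sum_list_triv dest!: list_all2_ball)
    have h: "runs (for_each (\<lambda>k. dot (col_of P k) ys) [0..<m]) (2 * m * n) (\<lambda>v. length v = m)"
      using len
      by (intro runs_weaken[OF runs_for_each[where P = "\<lambda>_ _. True" and k = "\<lambda>_. 2 * n"]])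
         (auto intro!: runs_weaken[OF runs_dot] simp: col_of_def sum_list_triv dest: list_all2_lengthD)
    have g: "runs (for_each (\<lambda>row. dot row h) Gi) (2 * m * m) (\<lambda>v. length v = m)"
      if "matrix_dims m m Gi" "length h = m" for Gi h
      using that
      by (intro runs_weaken[OF runs_for_each[where P = "\<lambda>_ _. True" and k = "\<lambda>_. 2 * m"]])
         (auto intro!: runs_weaken[OF runs_dot] simp: col_of_def sum_list_triv dest: list_all2_lengthD)
    show ?thesis
      unfolding least_squares_def
      apply (rule runs_weaken)
        apply (rule runs_bind[OF G])
        apply (rule runs_bind[OF h])
        apply (rule runs_bind[OF ki], assumption)
        apply (rule runs_bind[OF g], assumption, assumption)
        apply (rule runs_bind[OF runs_dot])
        apply (rule runs_bind[OF runs_weaken[OF runs_dot, of _ _ "2 * m" "\<lambda>_. True"]])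
          apply simp
         apply simp
        apply (rule runs_bind[OF runs_calc_any[of _ 3]])
         apply simp
        apply (rule runs_return[where P = "\<lambda>(\<gamma>, _). length \<gamma> = m"])
       apply (auto simp: len algebra_simps)
      done
  qed
  show ?thesis
    by (intro exI allI impI) (rule *, auto)
qed

lemma runs_poly_deriv:
  "\<exists>k. \<forall>c u. length c = m \<longrightarrow> runs (poly_deriv q c u) k (\<lambda>_. True)"
proof (intro exI allI impI)
  fix c :: "real list" and u assume "length c = m"
  \<comment> \<open>Per degree \<open>k\<close>: a subtraction and a product for each factor of the
    falling factorial, \<open>k - q\<close> products for the power of \<open>u\<close>, two for the
    term and one addition to the sum.\<close>
  then show "runs (poly_deriv q c u) (\<Sum>k\<leftarrow>[q..<Suc m]. (\<Sum>i\<leftarrow>[0..<q]. 1 + 1) + (k - q + 2) + 1) (\<lambda>_. True)"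
    unfolding poly_deriv_def
    apply (simp only:)
    apply (rule runs_sum_of)
    apply (rule runs_weaken)
      apply (rule runs_bind[OF runs_prod_of[OF runs_calc_any[of _ 1]]])
       apply simp
      apply (rule runs_bind[OF runs_pow])
      apply (rule runs_calc_any[of _ 2])
      apply auto
    done
qed

lemma runs_debias_weights: "\<exists>k. \<forall>a. runs (debias_weights J a) k (\<lambda>_. True)"
proof -
  obtain ki where ki: "\<And>A. matrix_dims (Suc J) (Suc J) A \<Longrightarrow> runs (inverse_of A) ki (matrix_dims (Suc J) (Suc J))"
    using runs_inverse_of[of "Suc J"] by blast
  \<comment> \<open>Per node, two operations for the inverse square of \<open>a r\<close> and
    \<open>Suc J\<close> products for its powers, together \<open>J + 3\<close>.\<close>
  have us: "runs (for_each (\<lambda>r. do { u \<leftarrow> calc (Val 1 \<oslash> (Val (a r) \<otimes> Val (a r)));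
                              powers u (Suc J) }) [0..<Suc J]) (Suc J * (J + 3)) (\<lambda>us. length us = Suc J)" for a :: "nat \<Rightarrow> real"
    by (intro runs_weaken[OF runs_for_each[OF runs_bind[OF runs_calc_any[of _ 2] runs_powers]]])
       (auto simp: sum_list_triv algebra_simps dest!: list_all2_lengthD)
  have "runs (debias_weights J a) (Suc J * (J + 3) + (ki + (2 * Suc J + 0))) (\<lambda>_. True)" for a
    unfolding debias_weights_def Let_def
    apply (rule runs_bind[OF us])
    apply (rule runs_bind[OF ki])
     apply (simp add: col_of_def)
     apply (rule runs_bind[OF runs_weaken[OF runs_dot, of _ _ "2 * Suc J" "\<lambda>_. True"]])
      apply (simp add: col_of_def)
     apply simp
    apply (rule runs_return)
    apply simp
    done
  then show ?thesis by blast
qed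

text \<open>Only building the design matrix and fitting it are loops over the sample; all later
  stages have sizes determined by \<open>d\<close> and \<open>J\<close>. Hence the cost is affine in
  \<open>n\<close>.\<close>

lemma runs_select_lifetime:
  "\<exists>k1 k2. \<forall>n X Y a x. runs (select_lifetime n X Y J a (x :: real ^ 'd::finite)) (k1 * n + k2) (\<lambda>_. True)"
proof -
  let ?p = "2 * J + 4"
  obtain k1 k2 where ls: "\<And>n P ys. length P = n \<Longrightarrow> length ys = n \<Longrightarrow>
     runs (least_squares (?p * CARD('d) + 1) P ys) (k1 * n + k2) (\<lambda>(\<gamma>, _). length \<gamma> = ?p * CARD('d) + 1)"
    using runs_least_squares[of "?p * CARD('d) + 1"] by blast
  obtain kp where kp: "\<And>m c u. length c = m \<Longrightarrow> runs (poly_deriv (2 * J + 2) c u) (kp m) (\<lambda>_. True)"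
    using runs_poly_deriv[of _ "2 * J + 2"] by metis
  obtain kw where kw: "\<And>a. runs (debias_weights J a) kw (\<lambda>_. True)"
    using runs_debias_weights by blast
  have P: "runs (for_each (\<lambda>i. design_row ?p (X i :: real ^ 'd)) [0..<n]) (n * (CARD('d) * ?p)) (\<lambda>P. length P = n)"
    for X n
    by (intro runs_weaken[OF runs_for_each[OF runs_design_row]])
       (auto simp: sum_list_triv dest!: list_all2_lengthD)
  \<comment> \<open>The block lengths are left in the form produced by \<open>take\<close> and
    \<open>drop\<close>; it is enough that they do not depend on the data.\<close>
  have D: "runs (sum_of (\<lambda>(c, j). poly_deriv (2 * J + 2) (take ?p (drop (1 + c * ?p) \<gamma>)) (x $ j))
            (List.enumerate 0 coords))
      (\<Sum>(c, j)\<leftarrow>List.enumerate 0 (coords :: 'd list). 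
          kp (min ?p (?p * CARD('d) + 1 - (1 + c * ?p))) + 1) (\<lambda>_. True)"
    if "length \<gamma> = ?p * CARD('d) + 1" for \<gamma> and x :: "real ^ 'd"
    unfolding case_prod_beta' using that by (intro runs_sum_of kp) (simp add: min.commute)
  have L: "runs (sum_of (\<lambda>r. sum_of (\<lambda>r'. do {
            l \<leftarrow> ell a r r';
            l' \<leftarrow> ell a r' r;
            s \<leftarrow> calc (Val l \<oplus> Val l');
            v \<leftarrow> pow s CARD('d);
            calc (Val (\<omega> ! r) \<otimes> Val (\<omega> ! r') \<otimes> Val v) }) [0..<Suc J]) [0..<Suc J])
      (\<Sum>r\<leftarrow>[0..<Suc J]. (\<Sum>r'\<leftarrow>[0..<Suc J]. (9 + (9 + (1 + (CARD('d) + 2)))) + 1) + 1) (\<lambda>_. True)" for a \<omega>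
    unfolding ell_def
    apply (rule runs_sum_of)
    apply (rule runs_sum_of)
    apply (rule runs_bind[OF runs_calc_any[of _ 9]], simp)
    apply (rule runs_bind[OF runs_calc_any[of _ 9]], simp)
    apply (rule runs_bind[OF runs_calc_any[of _ 1]], simp)
    apply (rule runs_bind[OF runs_pow])
    apply (rule runs_calc_any, simp)
    done
  \<comment> \<open>The cost of the stages after the fit is free of \<open>n\<close>, so the witness
    \<open>k\<close> is left open and determined by the rules applied to those stages.\<close>
  have *: "\<exists>k. \<forall>n X Y a x. runs (select_lifetime n X Y J a (x :: real ^ 'd)) 
     (n * (CARD('d) * ?p) + (k1 * n + k2 + k)) (\<lambda>_. True)"
    unfolding select_lifetime_def Let_def
    apply (rule exI)
    apply (intro allI)
    apply (rule runs_bind[OF P])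
    apply (rule runs_bind_pair[OF ls])
      apply assumption
     apply simp
    apply (rule runs_bind[OF D])
     apply simp
    apply (rule runs_bind_pair[OF kw])
    apply (rule runs_bind[OF L])
    apply (rule runs_bind[OF runs_calc_any[of _ 19]])
      apply simp
    apply (rule runs_return)
    apply simp
    done
  then obtain k where k: "\<And>n X Y a x. runs (select_lifetime n X Y J a (x :: real ^ 'd)) 
     (n * (CARD('d) * ?p) + (k1 * n + k2 + k)) (\<lambda>_. True)"
    by blast
  have "runs (select_lifetime n X Y J a (x :: real ^ 'd)) ((CARD('d) * ?p + k1) * n + (k2 + k)) (\<lambda>_. True)"
    for n X Y a x
    using k[of n X Y a x] by (simp add: algebra_simps)
  then show ?thesis by blast
qed


section \<open>Cells, union cell and active indices\<close>

lemma runs_for_each_map: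
  assumes "\<And>i. i \<in> set is \<Longrightarrow> runs (f i) k (\<lambda>v. v = g i)"
  shows "runs (for_each f is) (length is * k) (\<lambda>vs. vs = map g is)"
proof -
  have "runs (for_each f is) (\<Sum>i\<leftarrow>is. k) (\<lambda>vs. list_all2 (\<lambda>i v. v = g i) is vs)"
    by (intro runs_for_each assms)
  then show ?thesis
    by (rule runs_weaken) (auto simp: sum_list_triv list_all2_conv_all_nth intro: nth_equalityI)
qed

lemma runs_for_each_any:
  assumes "\<And>i. i \<in> set is \<Longrightarrow> runs (f i) k (\<lambda>_. True)"
  shows "runs (for_each f is) (length is * k) (\<lambda>_. True)"
  by (rule runs_weaken[OF runs_for_each[OF assms]]) (auto simp: sum_list_triv)

lemma runs_sum_of_const:
  assumes "\<And>i. i \<in> set is \<Longrightarrow> runs (f i) k (\<lambda>_. True)"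
  shows "runs (sum_of f is) (length is * (k + 1)) (\<lambda>_. True)"
  by (rule runs_weaken[OF runs_sum_of[OF assms]]) (auto simp: sum_list_triv)

lemma runs_forest_mean:
  assumes "\<And>b. b < B \<Longrightarrow> runs (f b) k (\<lambda>_. True)"
  shows "runs (forest_mean B f) (B * (k + 1) + 1) (\<lambda>_. True)"
proof -
  have "runs (sum_of f [0..<B]) (length [0..<B] * (k + 1)) (\<lambda>_. True)"
    by (rule runs_sum_of_const) (simp add: assms)
  then have "runs (sum_of f [0..<B]) (B * (k + 1)) (\<lambda>_. True)" by simp
  then show ?thesis
    unfolding forest_mean_def by (rule runs_bind[OF _ runs_calc_any]) simp
qed

text \<open>The sides of the cells, unlike the regression output, have to be tracked by value,
  because they decide which indices are active and thus the cost.\<close>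

definition cell_lo ::
  "(nat \<times> nat \<times> 'd::finite \<times> nat \<Rightarrow> real) \<Rightarrow> (nat \<Rightarrow> real) \<Rightarrow> real \<Rightarrow> real ^ 'd \<Rightarrow> nat \<Rightarrow> nat \<Rightarrow> 'd \<Rightarrow> real" where
  "cell_lo E a lam x r b j = max 0 (x $ j - E (b, r, j, 1) / (a r * lam))"

definition cell_hi ::
  "(nat \<times> nat \<times> 'd::finite \<times> nat \<Rightarrow> real) \<Rightarrow> (nat \<Rightarrow> real) \<Rightarrow> real \<Rightarrow> real ^ 'd \<Rightarrow> nat \<Rightarrow> nat \<Rightarrow> 'd \<Rightarrow> real" where
  "cell_hi E a lam x r b j = min 1 (x $ j + E (b, r, j, 2) / (a r * lam))"

text \<open>Describing a stored box by functions of the direction, rather than by positions in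
  \<open>coords\<close>, allows pointwise statements about its end points.\<close>

definition box_of :: "('d::finite \<Rightarrow> real) \<Rightarrow> ('d \<Rightarrow> real) \<Rightarrow> box" where
  "box_of l u = map (\<lambda>j. (l j, u j)) coords"

lemma length_box_of [simp]: "length (box_of l (u :: 'd::finite \<Rightarrow> real)) = CARD('d)"
  by (simp add: box_of_def)

text \<open>The ten operations per direction are two draws and four operations for each end
  point.\<close>

lemma runs_sample_cell:
  "runs (sample_cell E a lam (x :: real ^ 'd::finite) b r) (CARD('d) * 10)
     (\<lambda>T. T = box_of (cell_lo E a lam x r b) (cell_hi E a lam x r b))"
proof -
  have "runs (sample_cell E a lam x b r) (length (coords :: 'd list) * 10)
     (\<lambda>T. T = map (\<lambda>j. (cell_lo E a lam x r b j, cell_hi E a lam x r b j)) coords)"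
    unfolding sample_cell_def draw_def
  proof (rule runs_for_each_map)
    fix j :: 'd
    show "runs (do {
     e1 \<leftarrow> elem (E (b, r, j, 1));
     e2 \<leftarrow> elem (E (b, r, j, 2));
     l \<leftarrow> calc (Upper (Val 0) (Val (x $ j) \<ominus> Val e1 \<oslash> (Val (a r) \<otimes> Val lam)));
     u \<leftarrow> calc (Lower (Val 1) (Val (x $ j) \<oplus> Val e2 \<oslash> (Val (a r) \<otimes> Val lam)));
     State_Monad.return (l, u) }) 10 (\<lambda>v. v = (cell_lo E a lam x r b j, cell_hi E a lam x r b j))"
      apply (rule runs_weaken)
        apply (rule runs_bind[OF runs_elem[where P = "\<lambda>e. e = E (b, r, j, 1)"]], simp)
        apply (rule runs_bind[OF runs_elem[where P = "\<lambda>e. e = E (b, r, j, 2)"]], simp)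
        apply (rule runs_bind[OF runs_calc[where k = 4 and P = "\<lambda>l. l = cell_lo E a lam x r b j"]])
          apply simp
         apply (simp add: cell_lo_def)
        apply (rule runs_bind[OF runs_calc[where k = 4 and P = "\<lambda>l. l = cell_hi E a lam x r b j"]])
          apply simp
         apply (simp add: cell_hi_def)
        apply (rule runs_return[where P = "\<lambda>v. v = (cell_lo E a lam x r b j, cell_hi E a lam x r b j)"])
        apply simp_all
      done
  qed
  then show ?thesis by (simp add: box_of_def)
qed

text \<open>The four operations per direction are two comparisons, their conjunction, and the
  conjunction with the accumulated value.\<close>

lemma runs_in_box:
  assumes "length T = CARD('d)"
  shows "runs (in_box T (z :: real ^ 'd::finite)) (4 * CARD('d))
    (\<lambda>v. v = (\<forall>(j, l, u)\<in>set (zip coords T). l \<le> z $ j \<and> z $ j \<le> u))"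
proof -
  have "runs (in_box T z) (length (zip (coords :: 'd list) T) * (3 + 1))
     (\<lambda>v. v = (\<forall>t\<in>set (zip coords T). case t of (j, l, u) \<Rightarrow> l \<le> z $ j \<and> z $ j \<le> u))"
    unfolding in_box_def le_test_def
  proof (rule runs_all_of)
    fix t :: "'d \<times> real \<times> real"
    obtain j l u where [simp]: "t = (j, l, u)" by (cases t)
    show "runs (case t of (j, l, u) \<Rightarrow> do {
     p \<leftarrow> elem (l \<le> z $ j);
     q \<leftarrow> elem (z $ j \<le> u);
     elem (p \<and> q) }) 3 (\<lambda>v. v = (case t of (j, l, u) \<Rightarrow> l \<le> z $ j \<and> z $ j \<le> u))"
      unfolding \<open>t = _\<close> prod.case
      apply (rule runs_weaken)
        apply (rule runs_bind[OF runs_elem[where P = "\<lambda>e. e = (l \<le> z $ j)"]], simp)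
        apply (rule runs_bind[OF runs_elem[where P = "\<lambda>e. e = (z $ j \<le> u)"]], simp)
        apply (rule runs_elem[where P = "\<lambda>v. v = (l \<le> z $ j \<and> z $ j \<le> u)"])
        apply simp_all
      done
  qed
  then show ?thesis using assms by (simp add: mult.commute)
qed

lemma runs_in_box_any:
  assumes "length T = CARD('d)"
  shows "runs (in_box T (z :: real ^ 'd::finite)) (4 * CARD('d)) (\<lambda>_. True)"
  using runs_in_box[OF assms] by (rule runs_weaken) auto

lemma runs_in_box_of:
  "runs (in_box (box_of l u) (z :: real ^ 'd::finite)) (4 * CARD('d))
    (\<lambda>v. v = (\<forall>j. l j \<le> z $ j \<and> z $ j \<le> u j))"
  by (rule runs_weaken[OF runs_in_box]) (simp_all add: box_of_def zip_map2 zip_same_conv_map)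

abbreviation side :: "box \<Rightarrow> 'd::finite \<Rightarrow> real \<times> real" where
  "side T j \<equiv> the (map_of (zip coords T) j)"

lemma side_box_of: "side (box_of l u) j = (l j, u j)"
  by (simp add: box_of_def map_of_zip_map)

text \<open>The end points are characterised by the thresholds \<open>t\<close> on either side of
  them. This form passes through \<open>min\<close> and \<open>max\<close> as a disjunction, covers
  the degenerate initial interval, and yields membership in the union cell directly.\<close>

lemma runs_union_cell:
  fixes x :: "real ^ 'd::finite"
  assumes Ts: "\<And>T. T \<in> set Ts \<Longrightarrow> \<exists>l u. T = box_of (l :: 'd \<Rightarrow> real) u"
  shows "runs (union_cell x Ts) (length Ts * (CARD('d) * 2)) (\<lambda>U. \<exists>l u. U = box_of l u \<and>
    (\<forall>j t. l j \<le> t \<longleftrightarrow> x $ j \<le> t \<or> (\<exists>T\<in>set Ts. fst (side T j) \<le> t)) \<and>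
    (\<forall>j t. t \<le> u j \<longleftrightarrow> t \<le> x $ j \<or> (\<exists>T\<in>set Ts. t \<le> snd (side T j))))"
proof -
  let ?Inv = "\<lambda>Ts U. \<exists>l u. U = box_of l u \<and>
    (\<forall>j t. l j \<le> t \<longleftrightarrow> x $ j \<le> t \<or> (\<exists>T\<in>set Ts. fst (side T j) \<le> t)) \<and>
    (\<forall>j t. t \<le> u j \<longleftrightarrow> t \<le> x $ j \<or> (\<exists>T\<in>set Ts. t \<le> snd (side T j)))"
  let ?f = "\<lambda>((l, u), (l', u')). do {
       l'' \<leftarrow> calc (Lower (Val l) (Val l'));
       u'' \<leftarrow> calc (Upper (Val u) (Val u'));
       State_Monad.return (l'', u'') }"
  have "runs (union_cell x Ts) (\<Sum>T\<leftarrow>Ts. CARD('d) * 2) (?Inv Ts)"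
    unfolding union_cell_def
  proof (rule runs_iterate[where Inv = ?Inv])
    have "map (\<lambda>j. (x $ j, x $ j)) coords = box_of (($) x) (($) x)"
      by (simp add: box_of_def)
    then show "?Inv [] (map (\<lambda>j. (x $ j, x $ j)) coords)"
      by (auto intro!: exI[of _ "($) x"])
  next
    fix T Ts' U assume "T \<in> set Ts" "?Inv Ts' U"
    then obtain l u where U: "U = box_of l u"
      "\<And>j t. l j \<le> t \<longleftrightarrow> x $ j \<le> t \<or> (\<exists>T\<in>set Ts'. fst (side T j) \<le> t)"
      "\<And>j t. t \<le> u j \<longleftrightarrow> t \<le> x $ j \<or> (\<exists>T\<in>set Ts'. t \<le> snd (side T j))"
      by blast
    obtain l' u' where T: "T = box_of (l' :: 'd \<Rightarrow> real) u'"
      using Ts[OF \<open>T \<in> set Ts\<close>] by blast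
    have zip: "zip T U = map (\<lambda>j. ((l' j, u' j), (l j, u j))) coords"
      by (simp add: T U box_of_def zip_map_map zip_same_conv_map)
    have "runs (?f t) 2 (\<lambda>v. v = (min (fst (fst t)) (fst (snd t)), max (snd (fst t)) (snd (snd t))))"
      for t :: "(real \<times> real) \<times> real \<times> real"
    proof -
      obtain l u l' u' where t: "t = ((l, u), (l', u'))" by (metis surj_pair)
      show ?thesis
        unfolding t prod.case
        apply (rule runs_weaken)
          apply (rule runs_bind[OF runs_calc[where k = 1 and P = "\<lambda>v. v = min l l'"]])
            apply simp
           apply simp
          apply (rule runs_bind[OF runs_calc[where k = 1 and P = "\<lambda>v. v = max u u'"]])
            apply simp
           apply simp
          apply (rule runs_return[where P = "\<lambda>v. v = (min l l', max u u')"])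
          apply simp_all
        done
    qed
    then have "runs (for_each ?f (zip T U)) (length (zip T U) * 2)
       (\<lambda>v. v = map (\<lambda>t. (min (fst (fst t)) (fst (snd t)), max (snd (fst t)) (snd (snd t)))) (zip T U))"
      by (rule runs_for_each_map)
    then show "runs (for_each ?f (zip T U)) (CARD('d) * 2) (?Inv (Ts' @ [T]))"
    proof (rule runs_weaken)
      show "length (zip T U) * 2 = CARD('d) * 2" by (simp add: zip)
      fix v assume "v = map (\<lambda>t. (min (fst (fst t)) (fst (snd t)), max (snd (fst t)) (snd (snd t)))) (zip T U)"
      then have "v = box_of (\<lambda>j. min (l' j) (l j)) (\<lambda>j. max (u' j) (u j))"
        by (simp add: zip box_of_def)
      then show "?Inv (Ts' @ [T]) v"
        by (intro exI[of _ "\<lambda>j. min (l' j) (l j)"] exI[of _ "\<lambda>j. max (u' j) (u j)"])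
           (auto simp: min_le_iff_disj le_max_iff_disj U(2,3) T side_box_of)
    qed
  qed
  then show ?thesis by (simp add: sum_list_triv)
qed

lemma runs_active_indices:
  fixes X :: "nat \<Rightarrow> real ^ 'd::finite"
  shows "runs (active_indices n X (box_of l u)) (n * (4 * CARD('d)))
    (\<lambda>I. I = filter (\<lambda>i. \<forall>j. l j \<le> X i $ j \<and> X i $ j \<le> u j) [0..<n])"
proof -
  have "runs (active_indices n X (box_of l u)) (\<Sum>i\<leftarrow>[0..<n]. 4 * CARD('d) + 0)
    (\<lambda>I. I = filter (\<lambda>i. \<forall>j. l j \<le> X i $ j \<and> X i $ j \<le> u j) [0..<n])"
    unfolding active_indices_def
    apply (rule runs_iterate[where Inv = "\<lambda>js I. I = filter (\<lambda>i. \<forall>j. l j \<le> X i $ j \<and> X i $ j \<le> u j) js"])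
     apply simp
    apply (rule runs_bind[OF runs_in_box_of])
    apply (rule runs_return)
    apply simp
    done
  then show ?thesis by (simp add: sum_list_triv)
qed

text \<open>The indicator is multiplied in instead of branched on, so the updates of
  \<open>N\<close>, \<open>S\<close> and \<open>V\<close> cost 1, 2 and 3 operations whether or not
  the point lies in the cell.\<close>

lemma runs_cell_stats:
  fixes X :: "nat \<Rightarrow> real ^ 'd::finite"
  assumes "length T = CARD('d)"
  shows "runs (cell_stats X Y I T) (length I * (4 * CARD('d) + 6)) (\<lambda>_. True)"
proof -
  have "runs (cell_stats X Y I T) (\<Sum>i\<leftarrow>I. 4 * CARD('d) + 6) (\<lambda>_. True)"
    unfolding cell_stats_def Let_def
    apply (rule runs_iterate_any)
    apply (clarsimp split: prod.split)
    apply (rule runs_weaken)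
      apply (rule runs_bind[OF runs_in_box_any[OF assms]])
      apply (rule runs_bind[OF runs_calc_any[of _ 1]], simp)
      apply (rule runs_bind[OF runs_calc_any[of _ 2]], simp)
      apply (rule runs_bind[OF runs_calc_any[of _ 3]], simp)
      apply (rule runs_return[where P = "\<lambda>_. True"])
      apply simp_all
    done
  then show ?thesis by (simp add: sum_list_triv)
qed

text \<open>Membership of \<open>z\<close> in the union cell, without forming minima and maxima; the alternatives
  \<open>x $ j \<le> z $ j\<close> and \<open>z $ j \<le> x $ j\<close> are there because the program starts from the degenerate
  interval at \<open>x $ j\<close>.\<close>

definition active ::
  "(nat \<times> nat \<times> 'd::finite \<times> nat \<Rightarrow> real) \<Rightarrow> (nat \<Rightarrow> real) \<Rightarrow> real \<Rightarrow> real ^ 'd \<Rightarrow> nat \<Rightarrow> nat \<Rightarrow> real ^ 'd \<Rightarrow> bool" where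
  "active E a lam x B J z \<longleftrightarrow>
    (\<forall>j. (x $ j \<le> z $ j \<or> (\<exists>r\<in>{..J}. \<exists>b\<in>{..<B}. cell_lo E a lam x r b j \<le> z $ j)) \<and>
         (z $ j \<le> x $ j \<or> (\<exists>r\<in>{..J}. \<exists>b\<in>{..<B}. z $ j \<le> cell_hi E a lam x r b j)))"

text \<open>The constants precede \<open>n\<close>, \<open>B\<close>, the lifetime, the data and the
  exponential variables, so that the number of active indices is the only random part of the
  cost.\<close>

lemma runs_batch:
  fixes x :: "real ^ 'd::finite"
  shows "\<exists>c1 c2 c3 c4 c5. \<forall>n B lam X Y E.
    runs (batch \<alpha> a x n B J lam X Y E)
      (c1 * n + c2 * B + c3 + card {i\<in>{..<n}. active E a lam x B J (X i)} * (c4 * B + c5)) (\<lambda>_. True)"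
proof -
  obtain k1 k2 where sel: "\<And>n X Y a. runs (select_lifetime n X Y J a x) (k1 * n + k2) (\<lambda>_. True)"
    using runs_select_lifetime[of J] by blast
  let ?d = "CARD('d)"
  \<comment> \<open>The summands follow the order of the program. The two containing the cardinality
    come from the cell statistics and from the sum of squared weights in the variance
    estimate.\<close>
  have "runs (batch \<alpha> a x n B J lam X Y E)
     ((k1 * n + k2) + (Suc J * (B * (?d * 10)) + (Suc J * B * (?d * 2) + (n * (4 * ?d) +
       (Suc J * (B * (card {i\<in>{..<n}. active E a lam x B J (X i)} * (4 * ?d + 6))) +
       (Suc J * (B * 2 + 1 + 1 + 1) + ((B * 2 + 1) + ((B * 2 + 1) + (2 +
       (card {i\<in>{..<n}. active E a lam x B J (X i)} * ((Suc J * ((B * (4 * ?d + 2) + 1) + 1 + 1)) + 1 + 1) +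
       (?d + (3 + (2 + (1 + (1 + (1 + (6 + (6 + 0)))))))))))))))))) (\<lambda>_. True)" for n B lam X Y E
  proof -
    let ?T = "\<lambda>r b. box_of (cell_lo E a lam x r b) (cell_hi E a lam x r b)"
    let ?Ts = "map (\<lambda>r. map (?T r) [0..<B]) [0..<Suc J]"
    let ?I = "filter (\<lambda>i. active E a lam x B J (X i)) [0..<n]"
    have lenI: "length ?I = card {i\<in>{..<n}. active E a lam x B J (X i)}"
      by (subst distinct_card[symmetric]) (auto intro: arg_cong[where f = card])
    have Ts: "runs (for_each (\<lambda>r. for_each (\<lambda>b. sample_cell E a lam x b r) [0..<B]) [0..<Suc J])
       (Suc J * (B * (?d * 10))) (\<lambda>Ts. Ts = ?Ts)"
    proof -
      have "runs (for_each (\<lambda>b. sample_cell E a lam x b r) [0..<B]) (length [0..<B] * (?d * 10))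
         (\<lambda>Ts. Ts = map (?T r) [0..<B])" for r
        by (rule runs_for_each_map[OF runs_sample_cell])
      then have "runs (for_each (\<lambda>r. for_each (\<lambda>b. sample_cell E a lam x b r) [0..<B]) [0..<Suc J])
         (length [0..<Suc J] * (length [0..<B] * (?d * 10))) (\<lambda>Ts. Ts = ?Ts)"
        by (rule runs_for_each_map)
      then show ?thesis by simp
    qed
    have U: "runs (union_cell x (concat ?Ts)) (Suc J * B * (?d * 2))
      (\<lambda>U. \<exists>l u. U = box_of l u \<and> (\<forall>z. (\<forall>j. l j \<le> z $ j \<and> z $ j \<le> u j) \<longleftrightarrow> active E a lam x B J z))"
    proof (rule runs_weaken[OF runs_union_cell])
      show "\<exists>l u. T = box_of (l :: 'd \<Rightarrow> real) u" if T: "T \<in> set (concat ?Ts)" for T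
      proof -
        obtain r b where "T = ?T r b" using T by auto
        then show ?thesis by blast
      qed
      show "length (concat ?Ts) * (?d * 2) = Suc J * B * (?d * 2)"
        by (simp only: length_concat map_map o_def length_map length_upt) (simp add: sum_list_triv)
      \<comment> \<open>Quantifying over the flattened list of cells becomes quantifying over
        \<open>r\<close> and \<open>b\<close>, as in \<open>active\<close>.\<close>
      have set_Ts: "(\<exists>T\<in>set (concat ?Ts). P T) \<longleftrightarrow> (\<exists>r\<in>{..J}. \<exists>b\<in>{..<B}. P (?T r b))" for P
      proof -
        have "set (concat ?Ts) = (\<Union>r\<in>{..J}. ?T r ` {..<B})"
          unfolding set_concat set_map set_upt image_image atLeast0LessThan lessThan_Suc_atMost ..
        then show ?thesis by simp
      qed
      fix U
      assume "\<exists>l u. U = box_of l u \<and>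
         (\<forall>j t. l j \<le> t \<longleftrightarrow> x $ j \<le> t \<or> (\<exists>T\<in>set (concat ?Ts). fst (side T j) \<le> t)) \<and>
         (\<forall>j t. t \<le> u j \<longleftrightarrow> t \<le> x $ j \<or> (\<exists>T\<in>set (concat ?Ts). t \<le> snd (side T j)))"
      then obtain l u where "U = box_of l u"
        and "\<And>j t. l j \<le> t \<longleftrightarrow> x $ j \<le> t \<or> (\<exists>r\<in>{..J}. \<exists>b\<in>{..<B}. cell_lo E a lam x r b j \<le> t)"
        and "\<And>j t. t \<le> u j \<longleftrightarrow> t \<le> x $ j \<or> (\<exists>r\<in>{..J}. \<exists>b\<in>{..<B}. t \<le> cell_hi E a lam x r b j)"
        unfolding set_Ts side_box_of fst_conv snd_conv by blast
      then show "\<exists>l u. U = box_of l u \<and> (\<forall>z. (\<forall>j. l j \<le> z $ j \<and> z $ j \<le> u j) \<longleftrightarrow> active E a lam x B J z)"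
        unfolding active_def by (intro exI[of _ l] exI[of _ u]) simp
    qed
    have I: "runs (active_indices n X U) (n * (4 * ?d)) (\<lambda>I. I = ?I)"
      if "\<exists>l u. U = box_of l u \<and> (\<forall>z. (\<forall>j. l j \<le> z $ j \<and> z $ j \<le> u j) \<longleftrightarrow> active E a lam x B J z)" for U
      using that by (auto intro!: runs_weaken[OF runs_active_indices])
    have stats: "runs (for_each (for_each (cell_stats X Y ?I)) ?Ts)
       (Suc J * (B * (length ?I * (4 * ?d + 6)))) (\<lambda>_. True)"
    proof -
      have "runs (for_each (cell_stats X Y ?I) Tr) (B * (length ?I * (4 * ?d + 6))) (\<lambda>_. True)"
        if "Tr \<in> set ?Ts" for Tr
      proof -
        have "runs (for_each (cell_stats X Y ?I) Tr) (length Tr * (length ?I * (4 * ?d + 6))) (\<lambda>_. True)"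
          using that by (intro runs_for_each_any runs_cell_stats) auto
        moreover have "length Tr = B" using that by auto
        ultimately show ?thesis by simp
      qed
      then have "runs (for_each (for_each (cell_stats X Y ?I)) ?Ts)
          (length ?Ts * (B * (length ?I * (4 * ?d + 6)))) (\<lambda>_. True)"
        by (rule runs_for_each_any)
      then show ?thesis by (simp only: length_map length_upt diff_zero)
    qed
    have Q: "runs (sum_of (\<lambda>i. do {
         w \<leftarrow> sum_of (\<lambda>r. do {
             m \<leftarrow> forest_mean B (\<lambda>b. do {
                 c \<leftarrow> in_box (?Ts ! r ! b) (X i);
                 calc (Val (of_bool c) \<oslash> Val (N b r)) });
             calc (Val (\<omega> ! r) \<otimes> Val m) }) [0..<Suc J];
         calc (Val w \<otimes> Val w) }) ?I)
       (length ?I * ((Suc J * ((B * (4 * ?d + 2) + 1) + 1 + 1)) + 1 + 1)) (\<lambda>_. True)" for \<omega> N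
    proof -
      have "runs (forest_mean B (\<lambda>b. do {
                 c \<leftarrow> in_box (?Ts ! r ! b) (X i);
                 calc (Val (of_bool c) \<oslash> Val (N b r)) })) (B * ((4 * ?d + 1) + 1) + 1) (\<lambda>_. True)"
        if "r < Suc J" for r i
        using that
        by (intro runs_forest_mean runs_bind[OF runs_in_box_any runs_calc_any])
           (auto simp del: upt_Suc)
      from runs_bind[OF this runs_calc_any[of _ 1]]
      have "runs (do {
             m \<leftarrow> forest_mean B (\<lambda>b. do {
                 c \<leftarrow> in_box (?Ts ! r ! b) (X i);
                 calc (Val (of_bool c) \<oslash> Val (N b r)) });
             calc (Val (\<omega> ! r) \<otimes> Val m) }) (B * (4 * ?d + 2) + 1 + 1) (\<lambda>_. True)"
        if "r \<in> set [0..<Suc J]" for r i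
        using that by (simp del: upt_Suc)
      then have *: "runs (sum_of (\<lambda>r. do {
             m \<leftarrow> forest_mean B (\<lambda>b. do {
                 c \<leftarrow> in_box (?Ts ! r ! b) (X i);
                 calc (Val (of_bool c) \<oslash> Val (N b r)) });
             calc (Val (\<omega> ! r) \<otimes> Val m) }) [0..<Suc J]) (length [0..<Suc J] * (B * (4 * ?d + 2) + 1 + 1 + 1)) (\<lambda>_. True)" for i
        by (rule runs_sum_of_const)
      show ?thesis
        by (rule runs_weaken[OF runs_sum_of_const[OF runs_bind[OF * runs_calc_any[of _ 1]]]]) simp_all
    qed
    have fm: "runs (forest_mean B (\<lambda>b. calc (Val (S b) \<oslash> Val (N b)))) (B * 2 + 1) (\<lambda>_. True)" for S N
      by (rule runs_weaken[OF runs_forest_mean[OF runs_calc_any[of _ 1]]]) simp_all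
    have mu: "runs (sum_of (\<lambda>r. do {
         m \<leftarrow> forest_mean B (\<lambda>b. calc (Val (S b r) \<oslash> Val (N b r)));
         calc (Val (\<omega> ! r) \<otimes> Val m) }) [0..<Suc J]) (Suc J * (B * 2 + 1 + 1 + 1)) (\<lambda>_. True)" for S N \<omega>
    proof -
      have "runs (do {
         m \<leftarrow> forest_mean B (\<lambda>b. calc (Val (S b r) \<oslash> Val (N b r)));
         calc (Val (\<omega> ! r) \<otimes> Val m) }) (B * 2 + 1 + 1) (\<lambda>_. True)" for r
        by (rule runs_bind[OF fm runs_calc_any]) simp
      then have "runs (sum_of (\<lambda>r. do {
         m \<leftarrow> forest_mean B (\<lambda>b. calc (Val (S b r) \<oslash> Val (N b r)));
         calc (Val (\<omega> ! r) \<otimes> Val m) }) [0..<Suc J]) (length [0..<Suc J] * (B * 2 + 1 + 1 + 1)) (\<lambda>_. True)"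
        by (rule runs_sum_of_const)
      then show ?thesis by (simp only: length_upt diff_zero)
    qed
    show ?thesis
      unfolding batch_def Let_def lenI[symmetric]
      apply (rule runs_bind_pair[OF sel])
      apply (rule runs_bind[OF Ts])
      apply (simp only:)
      apply (rule runs_bind[OF U])
      apply (rule runs_bind[OF I], assumption)
      apply (simp only:)
      apply (rule runs_bind[OF stats])
      apply (rule runs_bind[OF mu])
      apply (rule runs_bind[OF fm])
      apply (rule runs_bind[OF fm])
      apply (rule runs_bind[OF runs_calc_any], simp)
      apply (rule runs_bind[OF Q])
      apply (rule runs_bind[OF runs_pow])
      apply (rule runs_bind[OF runs_calc_any], simp)
      apply (rule runs_bind[OF runs_calc_any], simp)
      apply (rule runs_bind[OF runs_calc_any], simp)
      apply (rule runs_bind[OF runs_elem[where P = "\<lambda>_. True"]], simp)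
      apply (rule runs_bind[OF runs_elem[where P = "\<lambda>_. True"]], simp)
      apply (rule runs_bind[OF runs_calc_any], simp)
      apply (rule runs_bind[OF runs_calc_any], simp)
      apply (rule runs_return)
      apply simp
      done
  qed
  note * = this
  \<comment> \<open>Regrouping by \<open>n\<close>, \<open>B\<close> and the number of active
    indices; the 12 is the cost 10 of sampling a side plus 2 for merging it into the union
    cell.\<close>
  have "runs (batch \<alpha> a x n B J lam X Y E)
     ((k1 + 4 * ?d) * n + (Suc J * (?d * 12) + Suc J * 2 + 4) * B
      + (k2 + Suc J * 3 + 24 + ?d) + card {i\<in>{..<n}. active E a lam x B J (X i)} *
        ((Suc J * (4 * ?d + 6) + Suc J * (4 * ?d + 2)) * B + (Suc J * 3 + 2))) (\<lambda>_. True)" for n B lam X Y E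
    by (rule runs_weaken[OF *]) (simp_all add: algebra_simps)
  then show ?thesis by blast
qed

section \<open>The probability of being active\<close>

text \<open>If the order of differentiation is zero, the Hoelder condition compares \<open>f\<close>
  with its value at the corner 0 over a bounded cube. Otherwise \<open>f\<close> is differentiable,
  hence continuous on a compact set. This supplies the bound on the density.\<close>

lemma holder_bounded_above:
  assumes "holder \<beta> (f :: real ^ 'd::finite \<Rightarrow> real)" "\<beta> > 0"
  shows "\<exists>K. \<forall>z\<in>cbox 0 1. f z \<le> K"
proof (cases "nat \<lceil>\<beta> - 1\<rceil> = 0")
  case True
  then obtain C where C: "\<And>z z'. z \<in> cbox 0 1 \<Longrightarrow> z' \<in> cbox 0 1 \<Longrightarrow> \<bar>f z - f z'\<bar> \<le> C * norm (z - z') powr \<beta>" "C > 0"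
    using assms(1) unfolding holder_def Let_def by auto
  obtain D where D: "\<And>z. z \<in> cbox 0 (1 :: real ^ 'd) \<Longrightarrow> norm z \<le> D"
    using bounded_cbox[of "0 :: real ^ 'd" 1] unfolding bounded_iff by blast
  have "f z \<le> f 0 + C * D powr \<beta>" if "z \<in> cbox 0 1" for z
  proof -
    have 0: "0 \<in> cbox 0 (1 :: real ^ 'd)" by (simp add: mem_box_cart)
    have "f z - f 0 \<le> C * norm z powr \<beta>"
      using C(1)[OF that 0] by simp
    also have "\<dots> \<le> C * D powr \<beta>"
      using D[OF that] C(2) assms(2) by (intro mult_left_mono powr_mono2) auto
    finally show ?thesis by simp
  qed
  then show ?thesis by blast
next
  case False
  then have "\<forall>js :: 'd list. length js < nat \<lceil>\<beta> - 1\<rceil> \<longrightarrow> partials js f differentiable_on cbox 0 1"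
    using assms(1) unfolding holder_def Let_def by blast
  from this[rule_format, of "[]"] False have "f differentiable_on cbox 0 1"
    by simp
  then have "compact (f ` cbox 0 1)"
    by (intro compact_continuous_image differentiable_imp_continuous_on compact_cbox)
  then have "bounded (f ` cbox 0 1)" by (rule compact_imp_bounded)
  then obtain K where "\<And>z. z \<in> cbox 0 1 \<Longrightarrow> \<bar>f z\<bar> \<le> K"
    unfolding bounded_iff by auto
  then show ?thesis by (meson abs_le_D1)
qed

section \<open>A data point in an independent random box\<close>

lemma emeasure_box_around:
  assumes "\<And>j. \<rho> $ j \<ge> 0"
  shows "emeasure lborel (cbox (x - \<rho>) (x + \<rho>)) = ennreal (\<Prod>j\<in>UNIV. 2 * \<rho> $ j)"
proof -
  have ne: "cbox (x - \<rho>) (x + \<rho>) \<noteq> {}"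
    using assms by (auto simp: interval_ne_empty_cart intro: order_trans[of _ 0])
  have "emeasure lborel (cbox (x - \<rho>) (x + \<rho>)) = ennreal (measure lborel (cbox (x - \<rho>) (x + \<rho>)))"
    by (rule emeasure_eq_ennreal_measure) (use emeasure_lborel_cbox_finite in \<open>auto simp: less_top[symmetric]\<close>)
  also have "\<dots> = ennreal (\<Prod>j\<in>UNIV. 2 * \<rho> $ j)"
    by (simp add: content_cbox_cart[OF ne])
  finally show ?thesis .
qed

lemma distributed_emeasure_le:
  assumes X: "distributed M lborel X (\<lambda>z. ennreal (indicator S z * f z))"
    and f: "\<And>z. z \<in> S \<Longrightarrow> f z \<le> K" and K: "K \<ge> 0" and A: "A \<in> sets borel"
  shows "emeasure M (X -` A \<inter> space M) \<le> ennreal K * emeasure lborel A"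
proof -
  have "emeasure M (X -` A \<inter> space M) = (\<integral>\<^sup>+z. ennreal (indicator S z * f z) * indicator A z \<partial>lborel)"
    using A by (intro distributed_emeasure[OF X]) simp
  also have "\<dots> \<le> (\<integral>\<^sup>+z. ennreal K * indicator A z \<partial>lborel)"
    using f K by (intro nn_integral_mono mult_right_mono ennreal_leI) (auto simp: indicator_def)
  also have "\<dots> = ennreal K * emeasure lborel A"
    using A by (simp add: nn_integral_cmult_indicator)
  finally show ?thesis .
qed

lemma borel_measurable_vec_nth [measurable]: "(\<lambda>v :: real ^ 'd::finite. v $ j) \<in> borel_measurable borel"
  by (intro borel_measurable_continuous_onI continuous_intros)

text \<open>By independence the joint law is a product. Fixing the radii first, the probability of
  the resulting box is at most \<open>K\<close> times its volume; integrating over the radii gives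
  the claim.\<close>

lemma (in prob_space) emeasure_in_random_box_le:
  fixes X R :: "'a \<Rightarrow> real ^ 'd::finite"
  assumes indep: "indep_var borel X borel R"
    and X: "distributed M lborel X (\<lambda>z. ennreal (indicator S z * f z))"
    and f: "\<And>z. z \<in> S \<Longrightarrow> f z \<le> K" and K: "K \<ge> 0"
    and R: "\<And>w j. w \<in> space M \<Longrightarrow> R w $ j \<ge> 0"
  shows "emeasure M {w \<in> space M. \<forall>j. \<bar>X w $ j - x $ j\<bar> \<le> R w $ j}
    \<le> ennreal K * (\<integral>\<^sup>+w. ennreal (\<Prod>j\<in>UNIV. 2 * R w $ j) \<partial>M)"
proof -
  have [measurable]: "X \<in> borel_measurable M" "R \<in> borel_measurable M"
    using indep indep_var_rv1 indep_var_rv2 by blast+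
  interpret X: prob_space "distr M borel X" by (rule prob_space_distr) simp
  interpret R: prob_space "distr M borel R" by (rule prob_space_distr) simp
  interpret pair_sigma_finite "distr M borel X" "distr M borel R" ..
  \<comment> \<open>The event as a set of pairs of a point and radii: it is closed, hence
    measurable, and its section at fixed radii is a box around \<open>x\<close>.\<close>
  let ?A = "{p :: (real ^ 'd) \<times> (real ^ 'd). \<forall>j. \<bar>fst p $ j - x $ j\<bar> \<le> snd p $ j}"
  have "closed ?A"
    by (intro closed_Collect_all closed_Collect_le continuous_intros)
  then have [measurable]: "?A \<in> sets (borel \<Otimes>\<^sub>M borel)"
    unfolding borel_prod by (rule borel_closed)
  have A: "(\<lambda>z. (z, \<rho>)) -` ?A = cbox (x - \<rho>) (x + \<rho>)" for \<rho>
    by (auto simp: space_pair_measure mem_box_cart abs_le_iff algebra_simps)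
  have "{w \<in> space M. \<forall>j. \<bar>X w $ j - x $ j\<bar> \<le> R w $ j} = (\<lambda>w. (X w, R w)) -` ?A \<inter> space M"
    by (auto simp: space_pair_measure)
  then have "emeasure M {w \<in> space M. \<forall>j. \<bar>X w $ j - x $ j\<bar> \<le> R w $ j}
      = emeasure (distr M (borel \<Otimes>\<^sub>M borel) (\<lambda>w. (X w, R w))) ?A"
    by (simp add: emeasure_distr)
  also have "\<dots> = emeasure (distr M borel X \<Otimes>\<^sub>M distr M borel R) ?A"
    using indep by (simp add: indep_var_distribution_eq)
  also have "\<dots> = (\<integral>\<^sup>+\<rho>. emeasure (distr M borel X) ((\<lambda>z. (z, \<rho>)) -` ?A) \<partial>distr M borel R)"
    by (rule emeasure_pair_measure_alt2) simp
  also have "\<dots> = (\<integral>\<^sup>+w. emeasure (distr M borel X) ((\<lambda>z. (z, R w)) -` ?A) \<partial>M)"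
  proof (rule nn_integral_distr)
    have "?A \<in> sets (distr M borel X \<Otimes>\<^sub>M distr M borel R)" by simp
    then show "(\<lambda>\<rho>. emeasure (distr M borel X) ((\<lambda>z. (z, \<rho>)) -` ?A)) \<in> borel_measurable (distr M borel R)"
      by (rule measurable_emeasure_Pair2)
  qed simp
  also have "\<dots> \<le> (\<integral>\<^sup>+w. ennreal K * ennreal (\<Prod>j\<in>UNIV. 2 * R w $ j) \<partial>M)"
  proof (rule nn_integral_mono)
    fix w assume w: "w \<in> space M"
    let ?C = "cbox (x - R w) (x + R w)"
    have "emeasure (distr M borel X) ?C = emeasure M (X -` ?C \<inter> space M)"
      by (simp add: emeasure_distr)
    also have "\<dots> \<le> ennreal K * ennreal (\<Prod>j\<in>UNIV. 2 * R w $ j)"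
      using distributed_emeasure_le[OF X f K, of ?C] emeasure_box_around[of "R w" x] R[OF w] by simp
    finally show "emeasure (distr M borel X) ((\<lambda>z. (z, R w)) -` ?A)
      \<le> ennreal K * ennreal (\<Prod>j\<in>UNIV. 2 * R w $ j)"
      unfolding A .
  qed
  also have "\<dots> = ennreal K * (\<integral>\<^sup>+w. ennreal (\<Prod>j\<in>UNIV. 2 * R w $ j) \<partial>M)"
    by (rule nn_integral_cmult) simp
  finally show ?thesis .
qed

text \<open>Preimages under \<open>X\<close> and \<open>Y\<close> generate sub-\<sigma>-algebras of
  \<open>F\<close> and \<open>G\<close>. This transfers independence of sample and trees to a single
  data point and the maximum of the exponential variables.\<close>

lemma (in prob_space) indep_var_of_indep_set:
  assumes FG: "indep_set (sets F) (sets G)" and [simp]: "space F = space M" "space G = space M"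
    and X: "X \<in> measurable F S" and Y: "Y \<in> measurable G T"
  shows "indep_var S X T Y"
proof -
  have sub: "sets F \<subseteq> events" "sets G \<subseteq> events"
    using FG unfolding indep_sets2_eq by auto
  have "sigma_sets (space M) {X -` A \<inter> space M | A. A \<in> sets S} \<subseteq> sets F"
    by (rule sets.sigma_sets_subset[of _ F, simplified]) (use measurable_sets[OF X] in auto)
  moreover have "sigma_sets (space M) {Y -` A \<inter> space M | A. A \<in> sets T} \<subseteq> sets G"
    by (rule sets.sigma_sets_subset[of _ G, simplified]) (use measurable_sets[OF Y] in auto)
  ultimately have "indep_set (sigma_sets (space M) {X -` A \<inter> space M | A. A \<in> sets S})
      (sigma_sets (space M) {Y -` A \<inter> space M | A. A \<in> sets T})"
    using FG unfolding indep_sets2_eq by blast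
  moreover have "random_variable S X" "random_variable T Y"
    using X Y sub by (auto simp: measurable_def)
  ultimately show ?thesis
    unfolding indep_var_eq by blast
qed

section \<open>Moments of the maximum of exponential variables\<close>

lemma power_le_fact_mult_exp:
  assumes "(y :: real) \<ge> 0"
  shows "y ^ d \<le> fact d * exp y"
proof -
  \<comment> \<open>A single term of the exponential series is at most the whole series.\<close>
  have "(\<Sum>n\<in>{d}. inverse (fact n) * y ^ n) \<le> (\<Sum>n. inverse (fact n) * y ^ n)"
    using assms by (intro sum_le_suminf summable_exp) auto
  then have "inverse (fact d) * y ^ d \<le> exp y"
    by (simp add: exp_def)
  then show ?thesis by (simp add: field_simps)
qed

text \<open>Split at \<open>4 * ln N\<close>. Above it \<open>exp (m / 4)\<close> exceeds
  \<open>N\<close>, so half of the exponent in \<open>exp (m / 2)\<close> can be traded for the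
  factor \<open>1 / N\<close>.\<close>

lemma power_le_ln_plus_exp:
  fixes m N :: real
  assumes "m \<ge> 0" "N \<ge> 1"
  shows "m ^ d \<le> (4 * ln N) ^ d + 4 ^ d * fact d * (exp (m / 2) / N)"
proof (cases "m \<le> 4 * ln N")
  case True
  then have "m ^ d \<le> (4 * ln N) ^ d" using assms by (intro power_mono) auto
  moreover have "0 \<le> 4 ^ d * fact d * (exp (m / 2) / N)" using assms by simp
  ultimately show ?thesis by linarith
next
  case False
  have "(m / 4) ^ d \<le> fact d * exp (m / 4)"
    using assms by (intro power_le_fact_mult_exp) simp
  then have "m ^ d \<le> 4 ^ d * (fact d * exp (m / 4))"
    by (simp add: power_divide field_simps)
  also have "exp (m / 4) \<le> exp (m / 2) / N"
  proof -
    have "exp (m / 4) = exp (m / 2) / exp (m / 4)" by (simp flip: exp_diff)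
    also have "\<dots> \<le> exp (m / 2) / exp (ln N)"
      using False by (intro divide_left_mono) auto
    finally show ?thesis using assms by simp
  qed
  finally have "m ^ d \<le> 4 ^ d * fact d * (exp (m / 2) / N)"
    by (simp add: mult_left_mono)
  moreover have "0 \<le> (4 * ln N) ^ d" using assms by simp
  ultimately show ?thesis by linarith
qed

text \<open>Tilting by \<open>exp (t / 2)\<close> turns the density of rate 1 into twice the density
  of rate 1/2. The absolute value costs nothing, as both densities vanish on the negative half-line,
  and makes the later maximum non-negative at every sample point.\<close>

lemma nn_integral_exp_half_exponential:
  assumes "distributed M lborel E (\<lambda>t. ennreal (exponential_density 1 t))"
  shows "(\<integral>\<^sup>+w. ennreal (exp (\<bar>E w\<bar> / 2)) \<partial>M) = 2"
proof -
  have "(\<integral>\<^sup>+w. ennreal (exp (\<bar>E w\<bar> / 2)) \<partial>M)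
     = (\<integral>\<^sup>+t. ennreal (exponential_density 1 t) * ennreal (exp (\<bar>t\<bar> / 2)) \<partial>lborel)"
    by (rule distributed_nn_integral[OF assms, symmetric]) simp
  also have "\<dots> = (\<integral>\<^sup>+t. 2 * ennreal (exponential_density (1 / 2) t) \<partial>lborel)"
  proof (rule nn_integral_cong)
    fix t :: real
    have "exponential_density 1 t * exp (\<bar>t\<bar> / 2) = 2 * exponential_density (1 / 2) t"
      by (auto simp: exponential_density_def exp_add[symmetric])
    then show "ennreal (exponential_density 1 t) * ennreal (exp (\<bar>t\<bar> / 2))
       = 2 * ennreal (exponential_density (1 / 2) t)"
      by (metis ennreal_mult' ennreal_mult'' ennreal_numeral exp_ge_zero zero_le_numeral)
  qed
  also have "\<dots> = 2 * (\<integral>\<^sup>+t. ennreal (exponential_density (1 / 2) t) \<partial>lborel)"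
    by (rule nn_integral_cmult) simp
  also have "(\<integral>\<^sup>+t. ennreal (exponential_density (1 / 2) t) \<partial>lborel) = 1"
  proof -
    interpret prob_space "density lborel (exponential_density (1 / 2))"
      by (rule prob_space_exponential_density) simp
    show ?thesis
      using emeasure_space_1 by (simp add: emeasure_density)
  qed
  finally show ?thesis by simp
qed

lemma (in prob_space) nn_integral_Max_exponential_power_le:
  fixes E :: "'i \<Rightarrow> 'a \<Rightarrow> real"
  assumes I: "finite I" "I \<noteq> {}"
    and E: "\<And>i. i \<in> I \<Longrightarrow> distributed M lborel (E i) (\<lambda>t. ennreal (exponential_density 1 t))"
    and N: "N \<ge> 1"
  shows "(\<integral>\<^sup>+w. ennreal (Max ((\<lambda>i. \<bar>E i w\<bar>) ` I) ^ d) \<partial>M)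
     \<le> ennreal (4 ^ d * (ln N ^ d + fact d * (2 * real (card I) / N)))"
proof -
  have [measurable]: "E i \<in> borel_measurable M" if "i \<in> I" for i
    using distributed_measurable[OF E[OF that]] by simp
  have "(\<integral>\<^sup>+w. ennreal (Max ((\<lambda>i. \<bar>E i w\<bar>) ` I) ^ d) \<partial>M)
     \<le> (\<integral>\<^sup>+w. ennreal ((4 * ln N) ^ d) + ennreal (4 ^ d * fact d / N) * (\<Sum>i\<in>I. ennreal (exp (\<bar>E i w\<bar> / 2))) \<partial>M)"
  proof (rule nn_integral_mono)
    fix w
    let ?m = "Max ((\<lambda>i. \<bar>E i w\<bar>) ` I)"
    \<comment> \<open>The maximum is attained at some index, so its exponential is one term of the
      sum over all indices; linearity of the integral then suffices.\<close>
    have "?m \<in> (\<lambda>i. \<bar>E i w\<bar>) ` I" using I by (intro Max_in) auto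
    then obtain i where i: "i \<in> I" "?m = \<bar>E i w\<bar>" by blast
    have "?m ^ d \<le> (4 * ln N) ^ d + 4 ^ d * fact d * (exp (?m / 2) / N)"
      using N i(2) by (intro power_le_ln_plus_exp) auto
    also have "exp (?m / 2) \<le> (\<Sum>i\<in>I. exp (\<bar>E i w\<bar> / 2))"
      unfolding i(2) using I i(1) by (intro member_le_sum) auto
    finally have "?m ^ d \<le> (4 * ln N) ^ d + 4 ^ d * fact d * ((\<Sum>i\<in>I. exp (\<bar>E i w\<bar> / 2)) / N)"
      using N by (simp add: mult_left_mono divide_right_mono)
    then have "ennreal (?m ^ d) \<le> ennreal ((4 * ln N) ^ d + (4 ^ d * fact d / N) * (\<Sum>i\<in>I. exp (\<bar>E i w\<bar> / 2)))"
      by (intro ennreal_leI) simp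
    also have "\<dots> = ennreal ((4 * ln N) ^ d) + ennreal (4 ^ d * fact d / N) * (\<Sum>i\<in>I. ennreal (exp (\<bar>E i w\<bar> / 2)))"
    proof -
      have "ennreal (p + q * s) = ennreal p + ennreal q * ennreal s" if "p \<ge> 0" "q \<ge> 0" "s \<ge> 0" for p q s
        using that by (simp add: ennreal_mult)
      from this[of "(4 * ln N) ^ d" "4 ^ d * fact d / N" "\<Sum>i\<in>I. exp (\<bar>E i w\<bar> / 2)"]
      show ?thesis using N by (simp only: sum_ennreal exp_ge_zero) (simp add: sum_nonneg)
    qed
    finally show "ennreal (?m ^ d) \<le> \<dots>" .
  qed
  also have "\<dots> = ennreal ((4 * ln N) ^ d)
      + ennreal (4 ^ d * fact d / N) * (\<Sum>i\<in>I. \<integral>\<^sup>+w. ennreal (exp (\<bar>E i w\<bar> / 2)) \<partial>M)"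
    by (simp add: nn_integral_add nn_integral_cmult nn_integral_sum emeasure_space_1 del: sum_ennreal)
  also have "\<dots> = ennreal ((4 * ln N) ^ d) + ennreal (4 ^ d * fact d / N) * ennreal (2 * real (card I))"
    by (simp add: nn_integral_exp_half_exponential[OF E] ennreal_mult mult.commute ennreal_of_nat_eq_real_of_nat)
  also have "\<dots> = ennreal (4 ^ d * (ln N ^ d + fact d * (2 * real (card I) / N)))"
    using N by (simp add: ennreal_mult[symmetric] ennreal_plus[symmetric] power_mult_distrib algebra_simps del: ennreal_plus)
  finally show ?thesis .
qed

section \<open>Bounding the probability of an active index\<close>

lemma active_imp_in_cube:
  fixes x z :: "real ^ 'd::finite"
  assumes act: "active E a lam x B J z" and lam: "lam > 0" and c: "c > 0"
    and a: "\<And>r. r \<le> J \<Longrightarrow> c \<le> a r"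
    and m: "m \<ge> 0" "\<And>b r j k. b < B \<Longrightarrow> r \<le> J \<Longrightarrow> k \<in> {1, 2} \<Longrightarrow> \<bar>E (b, r, j, k)\<bar> \<le> m"
  shows "\<bar>z $ j - x $ j\<bar> \<le> m / (c * lam)"
proof -
  \<comment> \<open>The numerator is at most \<open>m\<close> and the rate \<open>a r * lam\<close>
    at least \<open>c * lam\<close>.\<close>
  have E: "\<bar>E (b, r, j, k) / (a r * lam)\<bar> \<le> m / (c * lam)" if "b < B" "r \<le> J" "k \<in> {1, 2}" for b r k
  proof -
    have pos: "0 < c * lam" using c lam by simp
    have le: "c * lam \<le> a r * lam"
      using a[OF that(2)] lam by (intro mult_right_mono) auto
    have "0 < a r * lam" using pos le by (rule less_le_trans)
    then have "\<bar>E (b, r, j, k) / (a r * lam)\<bar> = \<bar>E (b, r, j, k)\<bar> / (a r * lam)"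
      by (simp only: abs_divide abs_of_pos)
    also have "\<dots> \<le> m / (c * lam)"
      by (rule frac_le[OF m(1) m(2)[OF that] pos le])
    finally show ?thesis .
  qed
  have "m / (c * lam) \<ge> 0" using m(1) c lam by simp
  \<comment> \<open>Truncation at 0 only raises the lower end point, so the untruncated one also
    lies below \<open>z $ j\<close>; in the excluded case the bound follows from non-negativity of
    the radius.\<close>
  moreover have "x $ j - m / (c * lam) \<le> z $ j" if less: "\<not> x $ j \<le> z $ j"
  proof -
    obtain r b where "r \<le> J" "b < B" "cell_lo E a lam x r b j \<le> z $ j"
      using act less unfolding active_def by blast
    moreover from this have "\<bar>E (b, r, j, 1) / (a r * lam)\<bar> \<le> m / (c * lam)"
      by (intro E) auto
    ultimately show ?thesis
      unfolding cell_lo_def abs_le_iff by linarith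
  qed
  moreover have "z $ j \<le> x $ j + m / (c * lam)" if less: "\<not> z $ j \<le> x $ j"
  proof -
    obtain r b where "r \<le> J" "b < B" "z $ j \<le> cell_hi E a lam x r b j"
      using act less unfolding active_def by blast
    moreover from this have "\<bar>E (b, r, j, 2) / (a r * lam)\<bar> \<le> m / (c * lam)"
      by (intro E) auto
    ultimately show ?thesis
      unfolding cell_hi_def abs_le_iff by linarith
  qed
  ultimately show ?thesis by linarith
qed

text \<open>An active point lies in a cube whose radius depends on the exponential variables only.
  The box estimate then leaves the moment of order \<open>d\<close> of their maximum.
  \<open>F\<close> stands for the information in the sample.\<close>

lemma (in prob_space) prob_active_le:
  fixes B J :: nat and X :: "'a \<Rightarrow> real ^ 'd::finite" and E :: "nat \<times> nat \<times> 'd \<times> nat \<Rightarrow> 'a \<Rightarrow> real"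
  defines "Idx \<equiv> {..<B} \<times> {..J} \<times> (UNIV :: 'd set) \<times> {1, 2}"
  assumes X: "distributed M lborel X (\<lambda>z. ennreal (indicator S z * f z))"
    and f: "\<And>z. z \<in> S \<Longrightarrow> f z \<le> K" and K: "K \<ge> 0"
    and E: "\<And>k. k \<in> Idx \<Longrightarrow> distributed M lborel (E k) (\<lambda>t. ennreal (exponential_density 1 t))"
    and FG: "indep_set (sets F) (sets (vimage_algebra (space M) (\<lambda>w. \<lambda>k\<in>Idx. E k w) (PiM Idx (\<lambda>_. borel))))"
    and F: "space F = space M" "X \<in> borel_measurable F"
    and B: "B \<ge> 1" and lam: "lam > 0" and c: "c > 0" and a: "\<And>r. r \<le> J \<Longrightarrow> c \<le> a r"
  shows "emeasure M {w \<in> space M. active (\<lambda>k. E k w) a lam x B J (X w)}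
    \<le> ennreal (K * (8 / (c * lam)) ^ CARD('d) *
        (ln (2 * real B * real (J + 1)) ^ CARD('d) + fact CARD('d) * (2 * real CARD('d))))"
proof -
  let ?d = "CARD('d)" and ?N = "2 * real B * real (J + 1)"
  let ?G = "vimage_algebra (space M) (\<lambda>w. \<lambda>k\<in>Idx. E k w) (PiM Idx (\<lambda>_. borel))"
  have N: "?N \<ge> 1"
    using B by (metis (no_types, opaque_lifting) mult.assoc mult_ge1_I of_nat_1 of_nat_le_iff one_le_numeral le_add2)
  have Idx: "finite Idx" "Idx \<noteq> {}" "card Idx = B * ((J + 1) * (?d * 2))"
    using B by (auto simp: Idx_def card_cartesian_product lessThan_empty_iff)
  define m where "m = (\<lambda>w. Max ((\<lambda>k. \<bar>E k w\<bar>) ` Idx))"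
  have m_ge: "\<bar>E k w\<bar> \<le> m w" if "k \<in> Idx" for k w
    unfolding m_def using that Idx by (intro Max_ge) auto
  have m_nonneg: "m w \<ge> 0" for w
    using m_ge Idx(2) abs_ge_zero by (metis ex_in_conv order_trans)
  define R where "R = (\<lambda>w. (m w / (c * lam)) *\<^sub>R (1 :: real ^ 'd))"
  have R_nonneg: "R w $ j \<ge> 0" for w j
    using m_nonneg c lam by (simp add: R_def)
  \<comment> \<open>Measurability with respect to \<open>?G\<close>, not just \<open>M\<close>, is
    what makes the radius independent of \<open>X\<close>.\<close>
  have EG: "E k \<in> borel_measurable ?G" if "k \<in> Idx" for k
  proof -
    have "(\<lambda>w. \<lambda>k\<in>Idx. E k w) \<in> measurable ?G (PiM Idx (\<lambda>_. borel))"
      by (rule measurable_vimage_algebra1) (auto simp: space_PiM)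
    from measurable_compose[OF this measurable_component_singleton[OF that]] show ?thesis
      using that by simp
  qed
  have "m \<in> borel_measurable ?G"
    unfolding m_def using EG Idx by (intro borel_measurable_Max) auto
  then have R: "R \<in> borel_measurable ?G"
    unfolding R_def by simp
  have "indep_var borel X borel R"
    by (rule indep_var_of_indep_set[OF FG F(1) _ F(2) R]) simp
  have "emeasure M {w \<in> space M. active (\<lambda>k. E k w) a lam x B J (X w)}
      \<le> emeasure M {w \<in> space M. \<forall>j. \<bar>X w $ j - x $ j\<bar> \<le> R w $ j}"
  proof (rule emeasure_mono)
    show "{w \<in> space M. active (\<lambda>k. E k w) a lam x B J (X w)}
      \<subseteq> {w \<in> space M. \<forall>j. \<bar>X w $ j - x $ j\<bar> \<le> R w $ j}"
      using m_nonneg m_ge lam c a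
      by (auto simp: R_def Idx_def intro!: active_imp_in_cube[where m = "m _"])
    have "X \<in> borel_measurable M" "R \<in> borel_measurable M"
      using \<open>indep_var borel X borel R\<close> indep_var_rv1 indep_var_rv2 by blast+
    note [measurable] = this
    show "{w \<in> space M. \<forall>j. \<bar>X w $ j - x $ j\<bar> \<le> R w $ j} \<in> events"
      by measurable
  qed
  also have "\<dots> \<le> ennreal K * (\<integral>\<^sup>+w. ennreal (\<Prod>j\<in>UNIV. 2 * R w $ j) \<partial>M)"
    by (rule emeasure_in_random_box_le[OF \<open>indep_var borel X borel R\<close> X f K R_nonneg])
  also have "(\<integral>\<^sup>+w. ennreal (\<Prod>j\<in>UNIV. 2 * R w $ j) \<partial>M)
      = (\<integral>\<^sup>+w. ennreal ((2 / (c * lam)) ^ ?d) * ennreal (m w ^ ?d) \<partial>M)"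
    using c lam m_nonneg
    by (intro nn_integral_cong) (simp add: R_def ennreal_mult[symmetric] power_mult_distrib power_divide)
  also have "\<dots> = ennreal ((2 / (c * lam)) ^ ?d) * (\<integral>\<^sup>+w. ennreal (m w ^ ?d) \<partial>M)"
  proof (rule nn_integral_cmult)
    have "E k \<in> borel_measurable M" if "k \<in> Idx" for k
      using distributed_measurable[OF E[OF that]] by simp
    then have "m \<in> borel_measurable M"
      unfolding m_def using Idx by (intro borel_measurable_Max) auto
    then show "(\<lambda>w. ennreal (m w ^ ?d)) \<in> borel_measurable M" by simp
  qed
  also have "(\<integral>\<^sup>+w. ennreal (m w ^ ?d) \<partial>M) \<le> ennreal (4 ^ ?d * (ln ?N ^ ?d + fact ?d * (2 * real (card Idx) / ?N)))"
    unfolding m_def by (rule nn_integral_Max_exponential_power_le[OF Idx(1,2) E N])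
  \<comment> \<open>Since \<open>Idx\<close> has \<open>d * ?N\<close> elements, the second term of
    the moment bound is a constant.\<close>
  also have "2 * real (card Idx) / ?N = 2 * real ?d"
  proof -
    have "2 * (b * (j * (d * 2))) / (2 * b * j) = 2 * d" if "b > 0" "j > 0" for b j d :: real
      using that by simp
    from this[of "real B" "real (J + 1)" "real ?d"] show ?thesis
      using B by (simp only: Idx(3) of_nat_mult of_nat_numeral)
  qed
  also have "ennreal K * (ennreal ((2 / (c * lam)) ^ ?d) * ennreal (4 ^ ?d * (ln ?N ^ ?d + fact ?d * (2 * real ?d))))
     = ennreal (K * (8 / (c * lam)) ^ ?d * (ln ?N ^ ?d + fact ?d * (2 * real ?d)))"
  proof -
    have "ln ?N \<ge> 0" using N by simp
    \<comment> \<open>The 8 combines the 2 from the edge length of the cube with the 4 from the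
      moment bound.\<close>
    moreover have "(8 / (c * lam)) ^ ?d = (2 / (c * lam)) ^ ?d * 4 ^ ?d"
      by (simp flip: power_mult_distrib)
    ultimately show ?thesis
      using K c lam by (simp add: ennreal_mult[symmetric] mult.assoc)
  qed
  finally show ?thesis
    by (simp add: mult_left_mono)
qed


text \<open>The exponential variables are known to be measurable only at the indices of the forest,
  so the argument keeps the quantifiers over \<open>r\<close> and \<open>b\<close> bounded.\<close>

lemma pred_active:
  fixes X :: "'w \<Rightarrow> real ^ 'd::finite"
  assumes [measurable]: "X \<in> borel_measurable M"
    and E: "\<And>k. k \<in> {..<B} \<times> {..J} \<times> UNIV \<times> {1, 2} \<Longrightarrow> E k \<in> borel_measurable M"
  shows "Measurable.pred M (\<lambda>w. active (\<lambda>k. E k w) a lam x B J (X w))"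
proof -
  have "Measurable.pred M (\<lambda>w. cell_lo (\<lambda>k. E k w) a lam x r b j \<le> X w $ j)"
    "Measurable.pred M (\<lambda>w. X w $ j \<le> cell_hi (\<lambda>k. E k w) a lam x r b j)"
    if "r \<in> {..J}" "b \<in> {..<B}" for r b j
  proof -
    have [measurable]: "E (b, r, j, 1) \<in> borel_measurable M" "E (b, r, j, 2) \<in> borel_measurable M"
      using that by (auto intro!: E)
    show "Measurable.pred M (\<lambda>w. cell_lo (\<lambda>k. E k w) a lam x r b j \<le> X w $ j)"
      "Measurable.pred M (\<lambda>w. X w $ j \<le> cell_hi (\<lambda>k. E k w) a lam x r b j)"
      unfolding cell_lo_def cell_hi_def by measurable
  qed
  moreover have "Measurable.pred M (\<lambda>w. x $ j \<le> X w $ j)" "Measurable.pred M (\<lambda>w. X w $ j \<le> x $ j)" for j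
    by measurable
  ultimately show ?thesis
    unfolding active_def by (intro pred_intros_countable pred_intros_logic pred_intros_finite) auto
qed

section \<open>The expected operation count\<close>

theorem lemma7:
  fixes M :: "'w measure"
    and X :: "nat \<Rightarrow> 'w \<Rightarrow> real ^ 'd::finite" and Y :: "nat \<Rightarrow> 'w \<Rightarrow> real"
    and E :: "nat \<Rightarrow> nat \<times> nat \<times> 'd \<times> nat \<Rightarrow> 'w \<Rightarrow> real"
    and f \<mu> \<sigma>2 :: "real ^ 'd \<Rightarrow> real" and \<beta>f \<beta>\<mu> \<beta>\<sigma> :: real
    and x :: "real ^ 'd" and lam :: "nat \<Rightarrow> real" and B :: "nat \<Rightarrow> nat"
    and J :: nat and a :: "nat \<Rightarrow> real" and \<alpha> :: real
  assumes "prob_space M"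
    \<comment> \<open>data\<close>
    and "prob_space.indep_vars M (\<lambda>_. borel) (\<lambda>i w. (X i w, Y i w)) UNIV"
    and "\<And>i. distr M borel (\<lambda>w. (X i w, Y i w)) = distr M borel (\<lambda>w. (X 0 w, Y 0 w))"
    and "\<And>i. distributed M lborel (X i) (\<lambda>z. ennreal (indicator (cbox 0 1) z * f z))"
    and "\<exists>c>0. \<forall>z\<in>cbox 0 1. c \<le> f z"
    and "\<beta>f > 0" and "holder \<beta>f f"
    and "\<exists>K. \<forall>i. AE w in M.
           nn_cond_exp M (vimage_algebra (space M) (X i) borel) (\<lambda>w. ennreal ((Y i w)\<^sup>2)) w \<le> ennreal K"
    and "\<And>i. AE w in M.
           real_cond_exp M (vimage_algebra (space M) (X i) borel) (Y i) w = \<mu> (X i w)"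
    and "\<beta>\<mu> > 0" and "holder \<beta>\<mu> \<mu>"
    and "\<And>i. AE w in M.
           real_cond_exp M (vimage_algebra (space M) (X i) borel) (\<lambda>w. (Y i w - \<mu> (X i w))\<^sup>2) w
             = \<sigma>2 (X i w)"
    and "\<exists>c>0. \<forall>z\<in>cbox 0 1. c \<le> \<sigma>2 z"
    and "\<beta>\<sigma> > 0" and "holder \<beta>\<sigma> \<sigma>2"
    \<comment> \<open>estimator\<close>
    and "x \<in> box 0 1"
    and "\<And>n. n \<ge> 1 \<Longrightarrow> lam n > 0" and "\<And>n. n \<ge> 1 \<Longrightarrow> B n \<ge> 1"
    and "lesssim (\<lambda>n. ln (real n) ^ 3) lam"
    and "filterlim (\<lambda>n. real n / lam n ^ CARD('d)) at_top sequentially"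
    and "lesssim (\<lambda>n. ln (real n) ^ CARD('d)) (\<lambda>n. real (B n))"
    \<comment> \<open>debiasing constants\<close>
    and "\<And>r. r \<le> J \<Longrightarrow> a r > 0" and "inj_on a {..J}"
    and "0 < \<alpha>" and "\<alpha> < 1"
    \<comment> \<open>exponential variables generating the trees\<close>
    and "\<And>n. n \<ge> 1 \<Longrightarrow> prob_space.indep_vars M (\<lambda>_. borel) (E n) ({..<B n} \<times> {..J} \<times> UNIV \<times> {1, 2})"
    and "\<And>n b r j k. n \<ge> 1 \<Longrightarrow> b < B n \<Longrightarrow> r \<le> J \<Longrightarrow> k \<in> {1, 2} \<Longrightarrow>
           distributed M lborel (E n (b, r, j, k)) (\<lambda>t. ennreal (exponential_density 1 t))"
    and "\<And>n. n \<ge> 1 \<Longrightarrow> prob_space.indep_set M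
           (sets (vimage_algebra (space M) (\<lambda>w. \<lambda>i\<in>{..<n}. (X i w, Y i w))
              (PiM {..<n} (\<lambda>_. borel))))
           (sets (vimage_algebra (space M) (\<lambda>w. \<lambda>k\<in>{..<B n} \<times> {..J} \<times> UNIV \<times> {1, 2}. E n k w)
              (PiM ({..<B n} \<times> {..J} \<times> UNIV \<times> {1, 2}) (\<lambda>_. borel))))"
  defines "T \<equiv> \<lambda>n w. op_count (batch \<alpha> a x n (B n) J (lam n) (\<lambda>i. X i w) (\<lambda>i. Y i w) (\<lambda>k. E n k w))"
  shows "(\<forall>n\<ge>1. integrable M (\<lambda>w. real (T n w))) \<and>
    lesssim (\<lambda>n. \<integral>w. real (T n w) \<partial>M)
      (\<lambda>n. real CARD('d) * real (J + 1) * (real n * real CARD('d) * real (J + 1) + real (B n))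
         + real n * real (B n) * real CARD('d) * real (J + 1)
             * ln (2 * real (B n) * real (J + 1)) ^ CARD('d) / lam n ^ CARD('d))"
proof -
  interpret prob_space M by fact
  let ?d = "CARD('d)"
  let ?Idx = "\<lambda>n. {..<B n} \<times> {..J} \<times> (UNIV :: 'd set) \<times> {1, 2 :: nat}"
  let ?A = "\<lambda>n i. {w \<in> space M. active (\<lambda>k. E n k w) a (lam n) x (B n) J (X i w)}"
  let ?L = "\<lambda>n. ln (2 * real (B n) * real (J + 1))"
  have lam: "lam n > 0" and B: "B n \<ge> 1" if "n \<ge> 1" for n
    using assms(17,18) that by auto
  have X: "distributed M lborel (X i) (\<lambda>z. ennreal (indicator (cbox 0 1) z * f z))" for i
    by fact
  have E: "distributed M lborel (E n k) (\<lambda>t. ennreal (exponential_density 1 t))"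
    if "n \<ge> 1" "k \<in> ?Idx n" for n k
    using that assms(27)[OF that(1)] by auto
  obtain K0 where "\<And>z. z \<in> cbox 0 1 \<Longrightarrow> f z \<le> K0"
    using holder_bounded_above[OF \<open>holder \<beta>f f\<close> \<open>\<beta>f > 0\<close>] by blast
  then obtain K where K: "K \<ge> 0" "\<And>z. z \<in> cbox 0 1 \<Longrightarrow> f z \<le> K"
    by (metis max.cobounded2 max.coboundedI1)
  \<comment> \<open>The least rate factor; it is positive as a minimum of finitely many positive
    numbers.\<close>
  define c where "c = Min (a ` {..J})"
  have c: "c > 0" "\<And>r. r \<le> J \<Longrightarrow> c \<le> a r"
    using \<open>\<And>r. r \<le> J \<Longrightarrow> a r > 0\<close> by (auto simp: c_def)
  obtain c1 c2 c3 c4 c5 where cost: "\<And>n B lam X Y E. runs (batch \<alpha> a x n B J lam X Y E)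
      (c1 * n + c2 * B + c3 + card {i\<in>{..<n}. active E a lam x B J (X i)} * (c4 * B + c5)) (\<lambda>_. True)"
    using runs_batch[of \<alpha> a x J] by blast
  \<comment> \<open>The count is affine in a sum of indicators, which yields both integrability and
    the expectation. The events are subsets of \<open>space M\<close>, so the identity is stated
    there.\<close>
  have T: "real (T n w) = real (c1 * n + c2 * B n + c3)
      + real (c4 * B n + c5) * (\<Sum>i<n. indicator (?A n i) w)" if "w \<in> space M" for n w
  proof -
    have "T n w = c1 * n + c2 * B n + c3
        + card {i\<in>{..<n}. active (\<lambda>k. E n k w) a (lam n) x (B n) J (X i w)} * (c4 * B n + c5)"
      unfolding T_def by (rule runs_op_count[OF cost])
    moreover have "(\<Sum>i<n. indicator (?A n i) w)
        = real (card {i\<in>{..<n}. active (\<lambda>k. E n k w) a (lam n) x (B n) J (X i w)})"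
      using that by (simp add: indicator_def sum.If_cases Int_def)
    ultimately show ?thesis by (simp add: mult.commute)
  qed
  have A: "?A n i \<in> events" if "n \<ge> 1" for n i
  proof -
    have "X i \<in> borel_measurable M" "\<And>k. k \<in> ?Idx n \<Longrightarrow> E n k \<in> borel_measurable M"
      using distributed_measurable[OF X] distributed_measurable[OF E[OF that]] by auto
    from pred_active[OF this] show ?thesis by (simp add: pred_def)
  qed
  have int: "integrable M (\<lambda>w. real (c1 * n + c2 * B n + c3)
      + real (c4 * B n + c5) * (\<Sum>i<n. indicator (?A n i) w))" if "n \<ge> 1" for n
    using A[OF that]
    by (intro Bochner_Integration.integrable_add integrable_const integrable_mult_right
        Bochner_Integration.integrable_sum integrable_real_indicator) (auto simp: emeasure_eq_measure)
  have "integrable M (\<lambda>w. real (T n w))" if "n \<ge> 1" for n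
    using int[OF that] by (subst Bochner_Integration.integrable_cong[OF refl T]) auto
  moreover have ET: "(\<integral>w. real (T n w) \<partial>M) = real (c1 * n + c2 * B n + c3)
      + real (c4 * B n + c5) * (\<Sum>i<n. prob (?A n i))" if "n \<ge> 1" for n
  proof -
    have "(\<integral>w. real (T n w) \<partial>M) = (\<integral>w. real (c1 * n + c2 * B n + c3)
      + real (c4 * B n + c5) * (\<Sum>i<n. indicator (?A n i) w) \<partial>M)"
      by (rule Bochner_Integration.integral_cong[OF refl T])
    also have "\<dots> = real (c1 * n + c2 * B n + c3) + real (c4 * B n + c5) * (\<Sum>i<n. prob (?A n i))"
      using A[OF that] by (subst Bochner_Integration.integral_add)
        (auto simp: prob_space Bochner_Integration.integral_sum emeasure_eq_measure intro!: Bochner_Integration.integrable_sum)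
    finally show ?thesis .
  qed
  \<comment> \<open>Because \<open>?L n\<close> is at least \<open>ln 2\<close>, the constant term
    of the probability bound is at most that constant times \<open>(?L n / ln 2) ^ d\<close>;
    \<open>D\<close> collects all factors of \<open>(?L n / lam n) ^ d\<close>.\<close>
  define D where "D = K * (8 / c) ^ ?d * (1 + fact ?d * (2 * real ?d) / ln 2 ^ ?d)"
  have "D \<ge> 0" using K c by (simp add: D_def)
  have L: "?L n \<ge> ln 2" if "n \<ge> 1" for n
  proof -
    have "1 * 1 \<le> real (B n) * real (J + 1)" using B[OF that] by (intro mult_mono) auto
    then show ?thesis by simp
  qed
  have prob_A: "prob (?A n i) \<le> D * (?L n ^ ?d / lam n ^ ?d)" if n: "n \<ge> 1" and i: "i < n" for n i
  proof -
    let ?F = "vimage_algebra (space M) (\<lambda>w. \<lambda>i\<in>{..<n}. (X i w, Y i w)) (PiM {..<n} (\<lambda>_. borel))"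
    have "(\<lambda>w. \<lambda>i\<in>{..<n}. (X i w, Y i w)) \<in> measurable ?F (PiM {..<n} (\<lambda>_. borel))"
      by (rule measurable_vimage_algebra1) (auto simp: space_PiM)
    from measurable_compose[OF this measurable_component_singleton[of i]]
    have "(\<lambda>w. (X i w, Y i w)) \<in> borel_measurable ?F" using i by simp
    \<comment> \<open>For \<open>i < n\<close> the point \<open>X i\<close> is the first component
      of a coordinate of the sample, hence measurable with respect to the \<sigma>-algebra of the
      data.\<close>
    then have XF: "X i \<in> borel_measurable ?F"
      using borel_measurable_continuous_onI[OF continuous_on_fst[OF continuous_on_id]]
      by (auto dest: measurable_compose)
    have "ennreal (prob (?A n i)) \<le> ennreal (K * (8 / (c * lam n)) ^ ?d * (?L n ^ ?d + fact ?d * (2 * real ?d)))"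
      using prob_active_le[OF X K(2,1) E[OF n] assms(28)[OF n] space_vimage_algebra XF B[OF n] lam[OF n] c]
      by (simp add: emeasure_eq_measure)
    moreover have "0 \<le> K * (8 / (c * lam n)) ^ ?d * (?L n ^ ?d + fact ?d * (2 * real ?d))"
      using K c lam[OF n] L[OF n] by (intro mult_nonneg_nonneg add_nonneg_nonneg zero_le_power) (auto intro: order_trans[rotated])
    ultimately have "prob (?A n i) \<le> K * (8 / (c * lam n)) ^ ?d * (?L n ^ ?d + fact ?d * (2 * real ?d))"
      by (simp add: ennreal_le_iff)
    also have "\<dots> \<le> K * (8 / (c * lam n)) ^ ?d * (?L n ^ ?d + fact ?d * (2 * real ?d) * (?L n ^ ?d / ln 2 ^ ?d))"
    proof -
      have "ln 2 ^ ?d \<le> ?L n ^ ?d" using L[OF n] by (intro power_mono) auto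
      then have "1 \<le> ?L n ^ ?d / ln 2 ^ ?d" by simp
      then have "fact ?d * (2 * real ?d) * 1 \<le> fact ?d * (2 * real ?d) * (?L n ^ ?d / ln 2 ^ ?d)"
        by (intro mult_left_mono) auto
      then show ?thesis using K c lam[OF n] by (intro mult_left_mono) auto
    qed
    also have "\<dots> = D * (?L n ^ ?d / lam n ^ ?d)"
      by (simp add: D_def power_divide power_mult_distrib field_simps)
    finally show ?thesis .
  qed
  \<comment> \<open>The first part of the constant pays for the deterministic cost, the part with
    \<open>D\<close> for the loops over active indices.\<close>
  have "(\<integral>w. real (T n w) \<partial>M) \<le> (real (c1 + c2 + c3) + D * real (c4 + c5)) *
      (real ?d * real (J + 1) * (real n * real ?d * real (J + 1) + real (B n))
         + real n * real (B n) * real ?d * real (J + 1) * ?L n ^ ?d / lam n ^ ?d)" (is "_ \<le> _ * (?u + ?v)")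
    if n: "n \<ge> 1" for n
  proof -
    let ?q = "?L n ^ ?d / lam n ^ ?d"
    have q: "?q \<ge> 0" using L[OF n] lam[OF n] by (intro divide_nonneg_nonneg zero_le_power) (auto intro: order_trans[rotated])
    \<comment> \<open>The factors \<open>d\<close> and \<open>J + 1\<close> are at least 1, so
      inserting them can only enlarge the bound.\<close>
    have ge1: "real ?d * real (J + 1) \<ge> 1" using mult_mono[of 1 "real ?d" 1 "real (J + 1)"] by simp
    have "real n + real (B n) \<le> real n * (real ?d * real (J + 1)) + real (B n)"
      using mult_left_mono[OF ge1, of "real n"] by simp
    also have "\<dots> \<le> real ?d * real (J + 1) * (real n * (real ?d * real (J + 1)) + real (B n))"
      using mult_right_mono[OF ge1, of "real n * (real ?d * real (J + 1)) + real (B n)"] by simp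
    finally have u: "real n + real (B n) \<le> ?u" by (simp add: mult.assoc)
    have v0: "0 \<le> real n * real (B n) * ?q" by (intro mult_nonneg_nonneg q) auto
    have "?v = real n * real (B n) * ?q * (real ?d * real (J + 1))"
      by (simp only: times_divide_eq_right times_divide_eq_left mult_ac)
    then have v: "real n * real (B n) * ?q \<le> ?v"
      using mult_left_mono[OF ge1 v0] by (simp only: mult_1_right)
    have "(\<Sum>i<n. prob (?A n i)) \<le> real n * (D * ?q)"
      using sum_bounded_above[of "{..<n}" "\<lambda>i. prob (?A n i)" "D * ?q"] prob_A[OF n] by simp
    \<comment> \<open>The constant \<open>c5\<close> is absorbed into a multiple of
      \<open>B n\<close>, as the forest has at least one tree per lifetime.\<close>
    then have "real (c4 * B n + c5) * (\<Sum>i<n. prob (?A n i)) \<le> real ((c4 + c5) * B n) * (real n * (D * ?q))"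
      using B[OF n] q \<open>D \<ge> 0\<close>
      by (intro mult_mono) (auto simp: algebra_simps sum_nonneg simp del: of_nat_add of_nat_mult intro!: sum_nonneg)
    also have "\<dots> = D * real (c4 + c5) * (real n * real (B n) * ?q)" by (simp add: mult_ac)
    also have "\<dots> \<le> D * real (c4 + c5) * (?u + ?v)"
    proof (rule mult_left_mono)
      show "real n * real (B n) * ?q \<le> ?u + ?v" using u v by linarith
    qed (simp add: \<open>D \<ge> 0\<close>)
    finally have 1: "real (c4 * B n + c5) * (\<Sum>i<n. prob (?A n i)) \<le> D * real (c4 + c5) * (?u + ?v)" .
    \<comment> \<open>Likewise \<open>c3\<close> is absorbed using \<open>n \<ge> 1\<close>.\<close>
    have "c1 * n + c2 * B n + c3 \<le> (c1 + c2 + c3) * (n + B n)"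
    proof -
      have "c3 \<le> c3 * n" using n by simp
      then show ?thesis unfolding distrib_left distrib_right by linarith
    qed
    then have "real (c1 * n + c2 * B n + c3) \<le> real (c1 + c2 + c3) * (real n + real (B n))"
      by (metis of_nat_add of_nat_le_iff of_nat_mult)
    also have "\<dots> \<le> real (c1 + c2 + c3) * (?u + ?v)"
      using u v v0 by (intro mult_left_mono) auto
    finally show ?thesis
      unfolding ET[OF n] using 1 by (simp only: distrib_right)
  qed
  ultimately show ?thesis
    unfolding lesssim_def by blast
qed

end
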